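(* Let $g\ge 3$ and let $G=C_{T_1,\dots,T_g}\in\mathcal{U}_{n,l}^{g,2}$. Then $U_{n,l}^{g,0}\prec G$.
   Context: For a graph $G$ on $n$ vertices with Laplacian matrix $L(G)=D(G)-A(G)$, write $\det(\lambda I_n-L(G))=\sum_{k=0}^n(-1)^k c_k(G)\lambda^{n-k}$. For graphs $G,H$ of order $n$, $G\preceq H$ means $c_k(G)\le c_k(H)$ for all $0\le k\le n$, and $G\prec H$ means $G\preceq H$ and $c_k(G)<c_k(H)$ for some $k$. A leaf is a vertex of degree $1$. $\mathcal{U}_{n,l}^g$ is the set of connected unicyclic graphs with $n$ vertices, exactly $l$ leaves and girth $g$; each such graph is written $C_{T_1,\dots,T_g}$, meaning it is obtained from the cycle $C_g=u_1\cdots u_g$ by attaching trees $T_1,\dots,T_g$ rooted at $u_1,\dots,u_g$. $\mathcal{U}_{n,l}^{g,2}$ is the set of $C_{T_1,\dots,T_g}\in\mathcal{U}_{n,l}^g$ such that $|V(T_1)|>1$, $|V(T_i)|>1$ for some $i\ne 1$, and $|V(T_j)|=1$ for all $j\ne 1,i$. The balanced starlike tree $BST_{m,l}$ is the tree of order $m$ with $l$ leaves obtained by identifying one end of each of $l$ paths, each of order $\lfloor\frac{m-1}{l}\rfloor+1$ or $\lceil\frac{m-1}{l}\rceil+1$, into a single vertex (its center). $U_{n,l}^{g,0}$ is the graph obtained from the cycle $C_g$ by identifying one cycle vertex with the center of $BST_{n-g+1,l}$. *)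

theory Defs
  imports "Graph_Theory.Graph_Theory" "Jordan_Normal_Form.Char_Poly" "HOL-Library.Extended_Nat"
begin

section \<open>Simple graphs\<close>

text \<open>
  Finite simple graphs are the \<^locale>\<open>pair_graph\<close>s of \<open>Graph_Theory\<close>: an edge is
  represented by the two arcs between its ends, so the degree of a vertex is its
  \<^const>\<open>out_degree\<close>.  The library's notions of \<open>cycle\<close> and \<open>tree\<close> are those of digraphs, where
  an edge traversed back and forth is already a cycle, so undirected cycles and trees are
  introduced here.
\<close>

definition graph_order :: "'a pair_pre_digraph \<Rightarrow> nat" where
  "graph_order G = card (pverts G)"

definition leaves :: "'a pair_pre_digraph \<Rightarrow> 'a set" where
  "leaves G = {v \<in> pverts G. out_degree (with_proj G) v = 1}"

definition path_graph :: "nat \<Rightarrow> (nat \<Rightarrow> 'a) \<Rightarrow> 'a pair_pre_digraph" where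
  "path_graph k p =
     (let E = {(p i, p (Suc i)) | i. i \<in> {1..<k}}
      in \<lparr> pverts = p ` {1..k}, parcs = E \<union> E\<inverse> \<rparr>)"

text \<open>The cycle \<open>u\<^sub>1 \<dots> u\<^sub>g\<close>, meaningful for \<open>g \<ge> 3\<close> and distinct \<open>u\<^sub>i\<close>.\<close>

definition cycle_graph :: "nat \<Rightarrow> (nat \<Rightarrow> 'a) \<Rightarrow> 'a pair_pre_digraph" where
  "cycle_graph g u =
     (let E = insert (u g, u 1) {(u i, u (Suc i)) | i. i \<in> {1..<g}}
      in \<lparr> pverts = u ` {1..g}, parcs = E \<union> E\<inverse> \<rparr>)"

definition cycle_subgraphs :: "'a pair_pre_digraph \<Rightarrow> 'a pair_pre_digraph set" where
  "cycle_subgraphs G = {C. (\<exists>g u. 3 \<le> g \<and> inj_on u {1..g} \<and> C = cycle_graph g u)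
                  \<and> subgraph (with_proj C) (with_proj G)}"

definition is_tree :: "'a pair_pre_digraph \<Rightarrow> bool" where
  "is_tree T \<longleftrightarrow> pair_graph T \<and> connected (with_proj T) \<and> cycle_subgraphs T = {}"

definition unicyclic :: "'a pair_pre_digraph \<Rightarrow> bool" where
  "unicyclic G \<longleftrightarrow> pair_graph G \<and> connected (with_proj G) \<and> (\<exists>!C. C \<in> cycle_subgraphs G)"

definition girth :: "'a pair_pre_digraph \<Rightarrow> enat" where
  "girth G = (INF C \<in> cycle_subgraphs G. enat (graph_order C))"

section \<open>Laplacian coefficients\<close>

definition degree_mat :: "'a pair_pre_digraph \<Rightarrow> 'a list \<Rightarrow> real mat" where
  "degree_mat G vs = mat (length vs) (length vs)
     (\<lambda>(i, j). if i = j then real (out_degree (with_proj G) (vs ! i)) else 0)"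

definition adjacency_mat :: "'a pair_pre_digraph \<Rightarrow> 'a list \<Rightarrow> real mat" where
  "adjacency_mat G vs = mat (length vs) (length vs)
     (\<lambda>(i, j). if (vs ! i, vs ! j) \<in> parcs G then 1 else 0)"

definition laplacian_mat :: "'a pair_pre_digraph \<Rightarrow> 'a list \<Rightarrow> real mat" where
  "laplacian_mat G vs = degree_mat G vs - adjacency_mat G vs"

text \<open>
  The matrices depend on the enumeration \<open>vs\<close> of the vertices; the characteristic polynomial
  does not, see \<open>laplacian_poly_eq\<close> below.
\<close>

definition laplacian_poly :: "'a pair_pre_digraph \<Rightarrow> real poly" where
  "laplacian_poly G =
     char_poly (laplacian_mat G (SOME vs. distinct vs \<and> set vs = pverts G))"

lemma laplacian_poly_eq:
  assumes "distinct vs" "set vs = pverts G"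
  shows "laplacian_poly G = char_poly (laplacian_mat G vs)"
proof -
  define f where "f = (\<lambda>x y. (if x = y then real (out_degree (with_proj G) x) else 0)
    - (if (x, y) \<in> parcs G then 1 else 0))"
  have L: "laplacian_mat G xs = mat (length xs) (length xs) (\<lambda>(i, j). f (xs ! i) (xs ! j))"
    if "distinct xs" for xs
    using that by (intro eq_matI)
      (auto simp: laplacian_mat_def degree_mat_def adjacency_mat_def f_def nth_eq_iff_index_eq)
  define ws where "ws = (SOME vs. distinct vs \<and> set vs = pverts G)"
  have "distinct ws \<and> set ws = pverts G"
    unfolding ws_def by (rule someI[of _ vs]) (use assms in auto)
  then have ws: "distinct ws" "set ws = set vs" using assms by auto
  define n where "n = length vs"
  have len: "length vs = n" "length ws = n"
    using ws assms distinct_card unfolding n_def by metis+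
  define P where "P = (\<lambda>(xs :: 'a list) (ys :: 'a list).
    mat n n (\<lambda>(i, j). if xs ! i = ys ! j then 1 else (0::real)))"
  have sum: "(\<Sum>k = 0..<n. (if a = xs ! k then 1 else 0) * h (xs ! k)) = (h a :: real)"
    if "distinct xs" "length xs = n" "a \<in> set xs" for a xs and h :: "'a \<Rightarrow> real"
  proof -
    have "(\<Sum>k = 0..<n. (if a = xs ! k then 1 else 0) * h (xs ! k))
        = (\<Sum>x \<in> set xs. (if a = x then 1 else 0) * h x)"
      by (rule sum.reindex_bij_betw[OF bij_betw_nth]) (use that in auto)
    also have "\<dots> = (\<Sum>x \<in> set xs. if a = x then h x else 0)"
      by (rule sum.cong) auto
    also have "\<dots> = h a" using that by simp
    finally show ?thesis .
  qed
  have PP: "P xs ys * P ys xs = 1\<^sub>m n"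
    if "distinct xs" "distinct ys" "length xs = n" "length ys = n" "set xs = set ys" for xs ys :: "'a list"
  proof (intro eq_matI)
    fix i j assume "i < dim_row (1\<^sub>m n :: real mat)" "j < dim_col (1\<^sub>m n :: real mat)"
    then have ij: "i < n" "j < n" by auto
    have "(P xs ys * P ys xs) $$ (i, j)
      = (\<Sum>k = 0..<n. (if xs ! i = ys ! k then 1 else 0) * (if ys ! k = xs ! j then 1 else 0))"
      using ij by (simp add: P_def scalar_prod_def)
    also have "\<dots> = (if xs ! i = xs ! j then 1 else 0)"
      using that ij nth_mem[of i xs]
      by (intro sum[of ys "xs ! i" "\<lambda>y. if y = xs ! j then 1 else 0"]) simp_all
    finally show "(P xs ys * P ys xs) $$ (i, j) = 1\<^sub>m n $$ (i, j)"
      using ij that by (simp add: nth_eq_iff_index_eq)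
  qed (auto simp: P_def)
  have "laplacian_mat G ws = P ws vs * laplacian_mat G vs * P vs ws"
  proof (intro eq_matI)
    fix i j
    assume "i < dim_row (P ws vs * laplacian_mat G vs * P vs ws)"
      and "j < dim_col (P ws vs * laplacian_mat G vs * P vs ws)"
    then have ij: "i < n" "j < n" by (auto simp: P_def)
    have wi: "ws ! i \<in> set vs" "ws ! j \<in> set vs"
      using ij len ws by (metis nth_mem)+
    have 1: "(P ws vs * laplacian_mat G vs) $$ (i, k) = f (ws ! i) (vs ! k)" if "k < n" for k
      using ij that len assms sum[OF assms(1) len(1) wi(1), of "\<lambda>y. f y (vs ! k)"]
      by (simp add: L P_def scalar_prod_def)
    have "(P ws vs * laplacian_mat G vs * P vs ws) $$ (i, j)
      = (\<Sum>k = 0..<n. (P ws vs * laplacian_mat G vs) $$ (i, k) * P vs ws $$ (k, j))"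
      using ij len assms
      by (subst index_mult_mat(1))
        (auto simp: L P_def scalar_prod_def simp del: index_mult_mat(1) intro!: sum.cong)
    also have "\<dots> = (\<Sum>k = 0..<n. (if ws ! j = vs ! k then 1 else 0) * f (ws ! i) (vs ! k))"
      by (rule sum.cong) (use ij 1 in \<open>auto simp: P_def\<close>)
    also have "\<dots> = f (ws ! i) (ws ! j)"
      by (rule sum[OF assms(1) len(1) wi(2)])
    finally show "laplacian_mat G ws $$ (i, j)
      = (P ws vs * laplacian_mat G vs * P vs ws) $$ (i, j)"
      using ij len ws by (simp add: L)
  qed (use ws len in \<open>auto simp: L P_def\<close>)
  moreover have "laplacian_mat G vs \<in> carrier_mat n n" "laplacian_mat G ws \<in> carrier_mat n n"
    using ws assms len by (auto simp: L)
  moreover have "P ws vs \<in> carrier_mat n n" "P vs ws \<in> carrier_mat n n"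
    by (auto simp: P_def)
  ultimately have "similar_mat (laplacian_mat G ws) (laplacian_mat G vs)"
    using PP[of ws vs] PP[of vs ws] ws assms len
    by (intro similar_matI[of _ _ "P ws vs" "P vs ws" n]) auto
  then show ?thesis
    unfolding laplacian_poly_def ws_def[symmetric] by (rule char_poly_similar)
qed

definition laplacian_coeff :: "'a pair_pre_digraph \<Rightarrow> nat \<Rightarrow> real" where
  "laplacian_coeff G k = (-1) ^ k * coeff (laplacian_poly G) (graph_order G - k)"

definition lap_le :: "'a pair_pre_digraph \<Rightarrow> 'b pair_pre_digraph \<Rightarrow> bool" (infix \<open>\<preceq>\<^sub>L\<close> 50) where
  "G \<preceq>\<^sub>L H \<longleftrightarrow> graph_order G = graph_order H
     \<and> (\<forall>k \<le> graph_order G. laplacian_coeff G k \<le> laplacian_coeff H k)"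

definition lap_less :: "'a pair_pre_digraph \<Rightarrow> 'b pair_pre_digraph \<Rightarrow> bool" (infix \<open>\<prec>\<^sub>L\<close> 50) where
  "G \<prec>\<^sub>L H \<longleftrightarrow> G \<preceq>\<^sub>L H
     \<and> (\<exists>k \<le> graph_order G. laplacian_coeff G k < laplacian_coeff H k)"

section \<open>Unicyclic graphs with given order, number of leaves and girth\<close>

definition unicyclic_graphs :: "nat \<Rightarrow> nat \<Rightarrow> nat \<Rightarrow> 'a pair_pre_digraph set" where
  "unicyclic_graphs n l g =
     {G. unicyclic G \<and> graph_order G = n \<and> card (leaves G) = l \<and> girth G = enat g}"

text \<open>
  \<open>G = C\<^bsub>T\<^sub>1,\<dots>,T\<^sub>g\<^esub>\<close>, where the tree \<open>T\<^sub>i\<close> has root \<open>u\<^sub>i\<close>.  Since \<open>u\<^sub>i\<close> is a vertex of \<open>T\<^sub>i\<close>,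
  disjointness of the trees implies that \<open>T\<^sub>i\<close> meets the cycle in \<open>u\<^sub>i\<close> only.
\<close>

definition cycle_with_trees ::
    "nat \<Rightarrow> (nat \<Rightarrow> 'a) \<Rightarrow> (nat \<Rightarrow> 'a pair_pre_digraph) \<Rightarrow> 'a pair_pre_digraph \<Rightarrow> bool" where
  "cycle_with_trees g u T G \<longleftrightarrow>
     inj_on u {1..g}
     \<and> (\<forall>i \<in> {1..g}. is_tree (T i) \<and> u i \<in> pverts (T i))
     \<and> (\<forall>i \<in> {1..g}. \<forall>j \<in> {1..g}. i \<noteq> j \<longrightarrow> pverts (T i) \<inter> pverts (T j) = {})
     \<and> pverts G = pverts (cycle_graph g u) \<union> (\<Union>i \<in> {1..g}. pverts (T i))
     \<and> parcs G = parcs (cycle_graph g u) \<union> (\<Union>i \<in> {1..g}. parcs (T i))"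

definition unicyclic_graphs2 :: "nat \<Rightarrow> nat \<Rightarrow> nat \<Rightarrow> 'a pair_pre_digraph set" where
  "unicyclic_graphs2 n l g =
     {G \<in> unicyclic_graphs n l g. \<exists>u T. cycle_with_trees g u T G
        \<and> graph_order (T 1) > 1
        \<and> (\<exists>i \<in> {1..g}. i \<noteq> 1 \<and> graph_order (T i) > 1
             \<and> (\<forall>j \<in> {1..g}. j \<noteq> 1 \<and> j \<noteq> i \<longrightarrow> graph_order (T j) = 1))}"

section \<open>Balanced starlike trees and the extremal graph\<close>

text \<open>
  \<open>is_BST m l c B\<close>: the graph \<open>B\<close> is (a copy of) \<open>BST\<^bsub>m,l\<^esub>\<close> with center \<open>c\<close>.  Its \<open>j\<close>-th path is
  \<open>p j 1, \<dots>, p j (k j)\<close>; the order \<open>m\<close> determines how many paths have which of the two orders.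
\<close>

definition is_BST :: "nat \<Rightarrow> nat \<Rightarrow> 'a \<Rightarrow> 'a pair_pre_digraph \<Rightarrow> bool" where
  "is_BST m l c B \<longleftrightarrow> graph_order B = m \<and>
     (\<exists>k p.
        (\<forall>j \<in> {1..l}. k j = nat \<lfloor>(real m - 1) / real l\<rfloor> + 1
                      \<or> k j = nat \<lceil>(real m - 1) / real l\<rceil> + 1)
        \<and> (\<forall>j \<in> {1..l}. inj_on (p j) {1..k j} \<and> p j 1 = c)
        \<and> (\<forall>i \<in> {1..l}. \<forall>j \<in> {1..l}. i \<noteq> j \<longrightarrow>
             pverts (path_graph (k i) (p i)) \<inter> pverts (path_graph (k j) (p j)) = {c})
        \<and> pverts B = (\<Union>j \<in> {1..l}. pverts (path_graph (k j) (p j)))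
        \<and> parcs B = (\<Union>j \<in> {1..l}. parcs (path_graph (k j) (p j))))"

text \<open>\<open>is_U0 n l g H\<close>: the graph \<open>H\<close> is (a copy of) \<open>U\<^bsub>n,l\<^esub>\<^bsup>g,0\<^esup>\<close>, for \<open>n \<ge> g \<ge> 3\<close> and \<open>l \<ge> 1\<close>.\<close>

definition is_U0 :: "nat \<Rightarrow> nat \<Rightarrow> nat \<Rightarrow> 'a pair_pre_digraph \<Rightarrow> bool" where
  "is_U0 n l g H \<longleftrightarrow>
     (\<exists>u c B. inj_on u {1..g} \<and> is_BST (n - g + 1) l c B
        \<and> pverts (cycle_graph g u) \<inter> pverts B = {c}
        \<and> pverts H = pverts (cycle_graph g u) \<union> pverts B
        \<and> parcs H = parcs (cycle_graph g u) \<union> parcs B)"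

end

theory Submission
  imports Defs
begin

text \<open>
  With \<open>P\<^sub>G(x) = det (xI + L(G))\<close> the Laplacian coefficient \<open>c\<^sub>k(G)\<close> is the coefficient of \<open>x\<^bsup>n-k\<^esup>\<close>
  in \<open>P\<^sub>G\<close>.  Write \<open>A\<^sub>T\<close> for this polynomial of a rooted tree \<open>T\<close>, \<open>B\<^sub>T\<close> for the minor at the root, and
  \<open>C\<^sub>T = A\<^sub>T - xB\<^sub>T\<close>; let \<open>q\<close>, \<open>p\<close>, \<open>p'\<close> be the determinants of the cycle with none, one and both of the
  attachment vertices deleted.  For trees \<open>T\<close>, \<open>S\<close> at distinct cycle vertices,
  \<open>P\<^sub>G = q B\<^sub>T B\<^sub>S + p (C\<^sub>T B\<^sub>S + B\<^sub>T C\<^sub>S) + p' C\<^sub>T C\<^sub>S\<close>, and moving \<open>S\<close> to the root of \<open>T\<close>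
  removes exactly the last term, which is nonnegative and nonzero.  For a single tree \<open>T\<close> at a cycle
  vertex \<open>P = (q - xp) B\<^sub>T + p A\<^sub>T\<close> with \<open>q - xp\<close> and \<open>p\<close> nonnegative, so it remains to see that \<open>A\<^sub>T\<close>
  and \<open>B\<^sub>T\<close> are coefficientwise minimal for the balanced starlike tree.  Moving all but one of the
  paths at an outermost branching vertex towards the root makes both smaller, provided that for
  \<open>A\<^sub>T\<close> the root is chosen at the center of the tree; equalizing the lengths of two paths at the
  root leaves \<open>A\<close> of these two paths unchanged and lowers \<open>B\<close>.
\<close>

section \<open>Polynomials with nonnegative coefficients\<close>

text \<open>Moving paths towards the root is safe when the path left behind is no longer than some
  path in the rest of the graph. For \<open>B\<close> the root is deleted and the comparison costs
  nothing. For \<open>A\<close> the rest must itself be deep enough, which forces two parts of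
  nearly equal height at the root, hence the center. The quantity really compared is the quotient
  \<open>C/B\<close>. Since the coefficientwise order does not survive division, each comparison is
  cross-multiplied; it then rests on the fact that prolonging by an edge acts on the pair
  \<open>(B, C)\<close> through a matrix of determinant 1. Both polynomials and all surroundings are
  treated at once through \<open>\<gamma> B + \<beta> A\<close>, where \<gamma> and \<beta> describe
  what else hangs at the root. The starlike trees obtained from \<open>A\<close> and from
  \<open>B\<close> may differ, but they agree in the number of edges and of paths, and balancing
  leads both to the same tree. The root is not counted as a leaf, so rerooting across an edge keeps
  the leaf count only if neither end is a leaf. Having two nontrivial trees on the cycle guarantees
  that the root of the glued tree has at least two children.\<close>

definition nonneg_poly :: "real poly \<Rightarrow> bool" where
  "nonneg_poly p \<longleftrightarrow> (\<forall>i. 0 \<le> coeff p i)"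

abbreviation coeff_le :: "real poly \<Rightarrow> real poly \<Rightarrow> bool" (infix \<open>\<le>\<^sub>p\<close> 50) where
  "p \<le>\<^sub>p q \<equiv> nonneg_poly (q - p)"

definition X :: "real poly" where "X = [:0, 1:]"

lemma poly_X [simp]: "poly X a = a"
  by (simp add: X_def)

lemma nonneg_poly_add [intro]: "nonneg_poly p \<Longrightarrow> nonneg_poly q \<Longrightarrow> nonneg_poly (p + q)"
  by (simp add: nonneg_poly_def)

lemma nonneg_poly_mult [intro]: "nonneg_poly p \<Longrightarrow> nonneg_poly q \<Longrightarrow> nonneg_poly (p * q)"
  by (auto simp: nonneg_poly_def coeff_mult intro!: sum_nonneg)

lemma nonneg_poly_0 [intro, simp]: "nonneg_poly 0"
  by (simp add: nonneg_poly_def)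

lemma nonneg_poly_1 [intro, simp]: "nonneg_poly 1"
  by (simp add: nonneg_poly_def)

lemma nonneg_poly_X [intro, simp]: "nonneg_poly X"
  by (auto simp: X_def nonneg_poly_def coeff_pCons split: nat.split)

lemma nonneg_poly_sum [intro]: "(\<And>i. i \<in> I \<Longrightarrow> nonneg_poly (f i)) \<Longrightarrow> nonneg_poly (sum f I)"
  by (auto simp: nonneg_poly_def coeff_sum intro!: sum_nonneg)

lemma nonneg_poly_poly: "nonneg_poly p \<Longrightarrow> 0 \<le> x \<Longrightarrow> 0 \<le> poly p x"
  by (auto simp: nonneg_poly_def poly_altdef intro!: sum_nonneg)

lemma coeff_le_trans [trans]: "p \<le>\<^sub>p q \<Longrightarrow> q \<le>\<^sub>p r \<Longrightarrow> p \<le>\<^sub>p r"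
  using nonneg_poly_add[of "q - p" "r - q"] by simp

lemma coeff_le_refl [simp]: "p \<le>\<^sub>p p"
  by simp

lemma coeff_le_mult: "nonneg_poly r \<Longrightarrow> p \<le>\<^sub>p q \<Longrightarrow> r * p \<le>\<^sub>p r * q"
  by (metis nonneg_poly_mult right_diff_distrib)

lemma coeff_le_add: "p \<le>\<^sub>p q \<Longrightarrow> p' \<le>\<^sub>p q' \<Longrightarrow> p + p' \<le>\<^sub>p q + q'"
  by (metis nonneg_poly_add add_diff_add)

section \<open>Rooted trees and their rooted-forest polynomials\<close>

text \<open>
  \<open>Branch t s\<close> is the rooted tree \<open>s\<close> with one more child of its root, which carries the subtree
  \<open>t\<close>.  As an unrooted tree it is \<open>t\<close> and \<open>s\<close> with their roots joined by an edge, so exchanging \<open>t\<close>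
  and \<open>s\<close> moves the root.
\<close>

datatype rooted_tree = Root | Branch rooted_tree rooted_tree

text \<open>
  For a tree with root \<open>r\<close> and Laplacian matrix \<open>L\<close>, \<open>root_poly\<close> is the determinant of \<open>xI + L\<close> with
  row and column \<open>r\<close> deleted, and \<open>full_poly\<close> is that of \<open>xI + L\<close>; \<open>nonroot_poly\<close> is the determinant
  of \<open>xI + L\<close> with the \<open>x\<close> at \<open>r\<close> removed.
\<close>

fun root_poly nonroot_poly :: "rooted_tree \<Rightarrow> real poly" where
  "root_poly Root = 1"
| "root_poly (Branch t s) = ((X + 1) * root_poly t + nonroot_poly t) * root_poly s"
| "nonroot_poly Root = 0"
| "nonroot_poly (Branch t s) = (X * root_poly t + nonroot_poly t) * root_poly s
     + ((X + 1) * root_poly t + nonroot_poly t) * nonroot_poly s"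

definition full_poly :: "rooted_tree \<Rightarrow> real poly" where
  "full_poly t = X * root_poly t + nonroot_poly t"

primrec num_edges :: "rooted_tree \<Rightarrow> nat" where
  "num_edges Root = 0"
| "num_edges (Branch t s) = Suc (num_edges t + num_edges s)"

text \<open>The root is never counted as a leaf.\<close>

primrec num_leaves :: "rooted_tree \<Rightarrow> nat" where
  "num_leaves Root = 0"
| "num_leaves (Branch t s) = (if t = Root then 1 else num_leaves t) + num_leaves s"

primrec tree_height :: "rooted_tree \<Rightarrow> nat" where
  "tree_height Root = 0"
| "tree_height (Branch t s) = max (Suc (tree_height t)) (tree_height s)"

primrec glue :: "rooted_tree \<Rightarrow> rooted_tree \<Rightarrow> rooted_tree" where
  "glue Root s = s"
| "glue (Branch a b) s = Branch a (glue b s)"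

primrec path_tree :: "nat \<Rightarrow> rooted_tree" where
  "path_tree 0 = Root"
| "path_tree (Suc k) = Branch (path_tree k) Root"

definition star_tree :: "nat list \<Rightarrow> rooted_tree" where
  "star_tree ks = foldr (\<lambda>k. glue (path_tree k)) ks Root"

lemma star_tree_simps [simp]:
  "star_tree [] = Root" "star_tree (k # ks) = glue (path_tree k) (star_tree ks)"
  by (simp_all add: star_tree_def)

lemma nonneg_rooted_tree [intro, simp]:
  "nonneg_poly (root_poly t)" "nonneg_poly (nonroot_poly t)"
  by (induction t) (auto intro!: nonneg_poly_mult nonneg_poly_add)

lemma nonneg_full_poly [intro, simp]: "nonneg_poly (full_poly t)"
  by (auto simp: full_poly_def intro!: nonneg_poly_mult nonneg_poly_add)

text \<open>Positivity at 1 certifies that a polynomial with nonnegative coefficients is nonzero;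
  strictness in the theorem is obtained this way.\<close>

lemma root_poly_at_1: "0 < poly (root_poly t) 1"
proof (induction t)
  case (Branch t s)
  then show ?case
    using nonneg_poly_poly[OF nonneg_rooted_tree(2), of 1 t]
    by (auto intro!: mult_pos_pos add_pos_nonneg)
qed auto

lemma nonroot_poly_at_1: "t \<noteq> Root \<Longrightarrow> 0 < poly (nonroot_poly t) 1"
proof (cases t)
  case (Branch a b)
  then show ?thesis
    using nonneg_poly_poly[OF nonneg_rooted_tree(2), of 1 a]
      nonneg_poly_poly[OF nonneg_rooted_tree(2), of 1 b] root_poly_at_1[of a] root_poly_at_1[of b]
    by (auto intro!: add_pos_nonneg mult_pos_pos mult_nonneg_nonneg add_nonneg_nonneg)
qed auto

lemma root_poly_glue [simp]: "root_poly (glue t s) = root_poly t * root_poly s"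
  by (induction t) (auto simp: algebra_simps)

text \<open>The root row of the glued tree is the sum of the two root rows, and deleting the root
  separates the parts. Linearity in that row gives a Leibniz rule; equivalently, \<open>C/B\<close>
  is additive under gluing.\<close>

lemma nonroot_poly_glue [simp]:
  "nonroot_poly (glue t s) = nonroot_poly t * root_poly s + root_poly t * nonroot_poly s"
  by (induction t) (auto simp: algebra_simps)

lemma num_edges_glue [simp]: "num_edges (glue t s) = num_edges t + num_edges s"
  by (induction t) auto

lemma num_leaves_glue [simp]: "num_leaves (glue t s) = num_leaves t + num_leaves s"
  by (induction t) auto

lemma tree_height_glue [simp]: "tree_height (glue t s) = max (tree_height t) (tree_height s)"
  by (induction t) auto

lemma glue_Root_right [simp]: "glue t Root = t"
  by (induction t) auto

lemma tree_height_path [simp]: "tree_height (path_tree k) = k"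
  by (induction k) auto

lemma num_leaves_eq_0: "num_leaves t = 0 \<longleftrightarrow> t = Root"
  by (induction t) auto

lemma tree_height_eq_0: "tree_height t = 0 \<longleftrightarrow> t = Root"
  by (cases t) auto

section \<open>Starlike trees\<close>

abbreviation path_root_poly :: "nat \<Rightarrow> real poly" where
  "path_root_poly k \<equiv> root_poly (path_tree k)"

abbreviation path_nonroot_poly :: "nat \<Rightarrow> real poly" where
  "path_nonroot_poly k \<equiv> nonroot_poly (path_tree k)"

text \<open>One more edge maps \<open>(B, C)\<close> to \<open>((X + 1) B + C, X B + C)\<close>, a
  linear map of determinant \<open>(X + 1) - X = 1\<close>. The cross difference of two paths is
  therefore unchanged when both lose an edge, and for \<open>k = 0\<close> it is \<open>C\<close> of
  the longer path.\<close>

lemma path_poly_cross: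
  "path_nonroot_poly (d + k) * path_root_poly k - path_root_poly (d + k) * path_nonroot_poly k
     = path_nonroot_poly d"
proof (induction k)
  case (Suc k)
  then show ?case
    by (simp add: algebra_simps)
qed simp

text \<open>Reordering the paths changes the term of type \<open>rooted_tree\<close>, so
  independence of the order can hold only for the polynomials.\<close>

lemma star_tree_remove1:
  assumes "k \<in> set ks"
  shows "root_poly (star_tree ks) = root_poly (star_tree (k # remove1 k ks))"
    and "nonroot_poly (star_tree ks) = nonroot_poly (star_tree (k # remove1 k ks))"
proof -
  have "root_poly (star_tree ks) = root_poly (star_tree (k # remove1 k ks))
    \<and> nonroot_poly (star_tree ks) = nonroot_poly (star_tree (k # remove1 k ks))"
    using assms by (induction ks) (auto simp: algebra_simps)
  then show "root_poly (star_tree ks) = root_poly (star_tree (k # remove1 k ks))"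
    and "nonroot_poly (star_tree ks) = nonroot_poly (star_tree (k # remove1 k ks))"
    by auto
qed

lemma star_tree_mset:
  assumes "mset ks = mset ls"
  shows "root_poly (star_tree ks) = root_poly (star_tree ls)"
    and "nonroot_poly (star_tree ks) = nonroot_poly (star_tree ls)"
proof -
  have "root_poly (star_tree ks) = root_poly (star_tree ls)
    \<and> nonroot_poly (star_tree ks) = nonroot_poly (star_tree ls)"
    using assms
  proof (induction ks arbitrary: ls)
    case (Cons k ks)
    have k: "k \<in> set ls" using Cons.prems by (metis list.set_intros(1) set_mset_mset)
    have "mset ks = mset (remove1 k ls)" using Cons.prems by (simp flip: Cons.prems)
    from Cons.IH[OF this] show ?case
      using star_tree_remove1[OF k] by simp
  qed auto
  then show "root_poly (star_tree ks) = root_poly (star_tree ls)"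
    and "nonroot_poly (star_tree ks) = nonroot_poly (star_tree ls)"
    by auto
qed

lemma star_tree_append:
  "star_tree (ks @ ls) = glue (star_tree ks) (star_tree ls)"
proof -
  have assoc: "glue (glue a b) c = glue a (glue b c)" for a b c
    by (induction a) auto
  show ?thesis by (induction ks) (auto simp: assoc)
qed

lemma tree_height_star_attained: "ks \<noteq> [] \<Longrightarrow> tree_height (star_tree ks) \<in> set ks"
proof (induction ks)
  case (Cons k ks)
  then show ?case by (cases "ks = []") (auto simp: max_def)
qed simp

lemma tree_height_star_remove1:
  assumes "k \<in> set ks" shows "tree_height (star_tree ks) = tree_height (star_tree (k # remove1 k ks))"
  using assms by (induction ks) auto

section \<open>Collapsing a tree to a starlike tree\<close>

text \<open>
  \<open>context_poly \<gamma> \<beta> t\<close> is \<open>det (xI + L)\<close> for \<open>t\<close> attached at a vertex \<open>r\<close> of a graph \<open>Z\<close>, if \<open>\<beta>\<close> and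
  \<open>\<gamma>\<close> are the polynomials \<open>root_poly\<close> and \<open>nonroot_poly\<close> of \<open>Z\<close> at \<open>r\<close>.
\<close>

definition context_poly :: "real poly \<Rightarrow> real poly \<Rightarrow> rooted_tree \<Rightarrow> real poly" where
  "context_poly \<gamma> \<beta> t = \<gamma> * root_poly t + \<beta> * full_poly t"

text \<open>Says, up to cross multiplication, that \<open>\<gamma> / \<beta>\<close> is at least as large as for a path with \<open>h\<close> edges.\<close>

definition dominates_paths :: "nat \<Rightarrow> real poly \<Rightarrow> real poly \<Rightarrow> bool" where
  "dominates_paths h \<gamma> \<beta> \<longleftrightarrow> (\<forall>e \<le> h. \<beta> * path_nonroot_poly e \<le>\<^sub>p \<gamma> * path_root_poly e)"

text \<open>Hanging a further graph with polynomials \<open>s\<close>, \<open>s'\<close> on the same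
  vertex adds \<open>s' / s\<close>, which is nonnegative, to \<gamma> / \<beta>.\<close>

lemma dominates_paths_glue:
  assumes "dominates_paths h \<gamma> \<beta>" "nonneg_poly \<beta>" "nonneg_poly s" "nonneg_poly s'"
  shows "dominates_paths h (\<gamma> * s + \<beta> * s') (\<beta> * s)"
  unfolding dominates_paths_def
proof (intro allI impI)
  fix e assume "e \<le> h"
  then have "nonneg_poly (s * (\<gamma> * path_root_poly e - \<beta> * path_nonroot_poly e)
      + \<beta> * s' * path_root_poly e)"
    using assms by (auto simp: dominates_paths_def intro!: nonneg_poly_add nonneg_poly_mult)
  then show "\<beta> * s * path_nonroot_poly e \<le>\<^sub>p (\<gamma> * s + \<beta> * s') * path_root_poly e"
    by (simp add: algebra_simps)
qed

text \<open>Surroundings and path are prolonged by the same map of determinant 1, so the cross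
  difference for \<open>Suc k\<close> is the old one for \<open>k\<close>.\<close>

lemma dominates_paths_edge:
  assumes "dominates_paths h \<gamma> \<beta>" "nonneg_poly \<beta>" "nonneg_poly \<gamma>"
  shows "dominates_paths (Suc h) (X * \<beta> + \<gamma>) ((X + 1) * \<beta> + \<gamma>)"
  unfolding dominates_paths_def
proof (intro allI impI)
  fix e assume e: "e \<le> Suc h"
  show "((X + 1) * \<beta> + \<gamma>) * path_nonroot_poly e \<le>\<^sub>p (X * \<beta> + \<gamma>) * path_root_poly e"
  proof (cases e)
    case 0
    have "nonneg_poly (X * \<beta> + \<gamma>)" using assms by (intro nonneg_poly_add nonneg_poly_mult) auto
    then show ?thesis using 0 by simp
  next
    case (Suc k)
    then have "\<beta> * path_nonroot_poly k \<le>\<^sub>p \<gamma> * path_root_poly k"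
      using assms e by (auto simp: dominates_paths_def)
    moreover have "(X * \<beta> + \<gamma>) * path_root_poly (Suc k) - ((X + 1) * \<beta> + \<gamma>) * path_nonroot_poly (Suc k)
       = \<gamma> * path_root_poly k - \<beta> * path_nonroot_poly k"
      by (simp add: algebra_simps)
    ultimately show ?thesis unfolding Suc by simp
  qed
qed

text \<open>A tree contains a path from the root to a deepest vertex, and whatever else hangs on
  that path only raises the quotient.\<close>

lemma dominates_paths_tree: "dominates_paths (tree_height t) (nonroot_poly t) (root_poly t)"
proof (induction t)
  case Root
  then show ?case by (auto simp: dominates_paths_def)
next
  case (Branch t s)
  have t: "dominates_paths (Suc (tree_height t)) (X * root_poly t + nonroot_poly t)
     ((X + 1) * root_poly t + nonroot_poly t)"
    by (rule dominates_paths_edge) (use Branch in auto)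
  have nn: "nonneg_poly (X * root_poly t + nonroot_poly t)"
     "nonneg_poly ((X + 1) * root_poly t + nonroot_poly t)"
    by (intro nonneg_poly_add nonneg_poly_mult; simp add: nonneg_poly_add)+
  \<comment> \<open>The height is attained either through the new child or in \<open>s\<close>; in
    each case the other part is the graph hung on in addition.\<close>
  have 1: "dominates_paths (Suc (tree_height t)) (nonroot_poly (Branch t s)) (root_poly (Branch t s))"
    using dominates_paths_glue[OF t nn(2) nonneg_rooted_tree[of s]] by simp
  have 2: "dominates_paths (tree_height s) (nonroot_poly (Branch t s)) (root_poly (Branch t s))"
    using dominates_paths_glue[OF Branch.IH(2) nonneg_rooted_tree(1) nn(2,1)] 
    by (simp add: mult.commute add.commute)
  show ?case using 1 2 by (auto simp: max_def)
qed

text \<open>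
  The non-path branches at a vertex are first collapsed recursively.  If the subtree at a child of
  the root is a bundle of paths, all of them except a longest one are moved to the root; the
  polynomial does not increase since the rest of the graph dominates the path that stays.
\<close>

lemma collapse:
  assumes "dominates_paths h \<gamma> \<beta>" "nonneg_poly \<gamma>" "nonneg_poly \<beta>" "tree_height t \<le> Suc h"
  shows "\<exists>ks. sum_list ks = num_edges t \<and> length ks = num_leaves t
    \<and> tree_height (star_tree ks) = tree_height t
    \<and> context_poly \<gamma> \<beta> (star_tree ks) \<le>\<^sub>p context_poly \<gamma> \<beta> t"
  using assms
proof (induction t arbitrary: h \<gamma> \<beta>)
  case Root
  show ?case by (rule exI[of _ "[]"]) auto
next
  case (Branch a s)
  let ?pb = "(X + 1) * root_poly a + nonroot_poly a"
  let ?pc = "X * root_poly a + nonroot_poly a"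
  have nn: "nonneg_poly ?pb" "nonneg_poly ?pc"
    by (intro nonneg_poly_add nonneg_poly_mult; simp add: nonneg_poly_add)+
  let ?\<gamma>' = "\<gamma> * ?pb + \<beta> * ?pc" and ?\<beta>' = "\<beta> * ?pb"
  have nn': "nonneg_poly ?\<gamma>'" "nonneg_poly ?\<beta>'"
    using Branch.prems nn by (auto intro!: nonneg_poly_add nonneg_poly_mult)
  \<comment> \<open>While \<open>s\<close> is being collapsed, the branch carrying \<open>a\<close>
    belongs to the surroundings.\<close>
  have "dominates_paths h ?\<gamma>' ?\<beta>'"
    using Branch.prems nn by (intro dominates_paths_glue) auto
  from Branch.IH(2)[OF this nn'] Branch.prems obtain ks where
    ks: "sum_list ks = num_edges s" "length ks = num_leaves s"
      "tree_height (star_tree ks) = tree_height s"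
      "context_poly ?\<gamma>' ?\<beta>' (star_tree ks) \<le>\<^sub>p context_poly ?\<gamma>' ?\<beta>' s"
    by auto
  have ev1: "context_poly ?\<gamma>' ?\<beta>' t = context_poly \<gamma> \<beta> (Branch a t)" for t
    by (simp add: context_poly_def full_poly_def algebra_simps)
  let ?sb = "root_poly (star_tree ks)" and ?sc = "nonroot_poly (star_tree ks)"
  define \<gamma>1 where "\<gamma>1 = \<gamma> * ?sb + \<beta> * ?sc"
  define \<beta>1 where "\<beta>1 = \<beta> * ?sb"
  have nn1: "nonneg_poly \<gamma>1" "nonneg_poly \<beta>1"
    using Branch.prems by (auto simp: \<gamma>1_def \<beta>1_def intro!: nonneg_poly_add nonneg_poly_mult)
  have dom1: "dominates_paths h \<gamma>1 \<beta>1" unfolding \<gamma>1_def \<beta>1_def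
    using Branch.prems by (intro dominates_paths_glue) auto
  \<comment> \<open>The same surroundings, now including the collapsed \<open>s\<close>, seen from
    the child across its edge: the dominated length grows by one.\<close>
  let ?\<gamma>2 = "X * \<beta>1 + \<gamma>1" and ?\<beta>2 = "(X + 1) * \<beta>1 + \<gamma>1"
  have nn2: "nonneg_poly ?\<gamma>2" "nonneg_poly ?\<beta>2"
    using nn1 by (auto intro!: nonneg_poly_add nonneg_poly_mult)
  have "dominates_paths (Suc h) ?\<gamma>2 ?\<beta>2"
    by (rule dominates_paths_edge[OF dom1 nn1(2,1)])
  from Branch.IH(1)[OF this nn2] Branch.prems obtain ls where
    ls: "sum_list ls = num_edges a" "length ls = num_leaves a"
      "tree_height (star_tree ls) = tree_height a"
      "context_poly ?\<gamma>2 ?\<beta>2 (star_tree ls) \<le>\<^sub>p context_poly ?\<gamma>2 ?\<beta>2 a"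
    by auto
  have ev2: "context_poly ?\<gamma>2 ?\<beta>2 t = context_poly \<gamma> \<beta> (Branch t (star_tree ks))" for t
    by (simp add: context_poly_def full_poly_def algebra_simps \<gamma>1_def \<beta>1_def)
  have le: "context_poly \<gamma> \<beta> (Branch (star_tree ls) (star_tree ks)) \<le>\<^sub>p context_poly \<gamma> \<beta> (Branch a s)"
    using coeff_le_trans[OF ls(4)[unfolded ev2] ks(4)[unfolded ev1]] .
  show ?case
  proof (cases "a = Root")
    case True
    with ls have "ls = []" by simp
    then show ?thesis using True ks le
      by (intro exI[of _ "1 # ks"]) auto
  next
    case False
    then have "ls \<noteq> []" using ls(2) num_leaves_eq_0[of a] by auto
    then obtain e where e: "e \<in> set ls" "e = tree_height a"
      using tree_height_star_attained ls(3) by metis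
    define ws where "ws = remove1 e ls"
    let ?wb = "root_poly (star_tree ws)" and ?wc = "nonroot_poly (star_tree ws)"
    \<comment> \<open>One path stays at the child, so that the child does not become an additional
      leaf; together with the edge to the root it has length \<open>Suc e\<close>. Since
      \<open>e\<close> is the largest length, the height is preserved.\<close>
    let ?ks = "Suc e # ws @ ks"
    have eh: "e \<le> h" using e Branch.prems by simp
    have ms: "mset ls = mset (e # ws)"
      using e(1) unfolding ws_def by simp
    have sum: "sum_list ls = e + sum_list ws"
      using arg_cong[OF ms, of sum_mset] by (simp only: sum_mset_sum_list) simp
    have len: "length ls = Suc (length ws)"
      using arg_cong[OF ms, of size] by (simp only: size_mset) simp
    have "max e (tree_height (star_tree ws)) = e"
      using tree_height_star_remove1[OF e(1)] ls(3) e unfolding ws_def by simp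
    then have height: "tree_height (star_tree ?ks) = tree_height (Branch a s)"
      using ks(3) e by (auto simp: star_tree_append max_def)
    \<comment> \<open>The gain factors: \<open>C\<close> of the moved bundle times the cross
      difference between the surroundings at the root and the path that stays.\<close>
    have "context_poly \<gamma> \<beta> (Branch (star_tree ls) (star_tree ks)) - context_poly \<gamma> \<beta> (star_tree ?ks)
        = ?wc * (\<gamma>1 * path_root_poly e - \<beta>1 * path_nonroot_poly e)"
      using star_tree_remove1[OF e(1)]
      by (simp add: context_poly_def full_poly_def star_tree_append \<gamma>1_def \<beta>1_def
          algebra_simps flip: ws_def)
    moreover have "nonneg_poly (?wc * (\<gamma>1 * path_root_poly e - \<beta>1 * path_nonroot_poly e))"
      using dom1 eh by (auto simp: dominates_paths_def intro!: nonneg_poly_mult)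
    ultimately have "context_poly \<gamma> \<beta> (star_tree ?ks) \<le>\<^sub>p
        context_poly \<gamma> \<beta> (Branch (star_tree ls) (star_tree ks))" by simp
    then have "context_poly \<gamma> \<beta> (star_tree ?ks) \<le>\<^sub>p context_poly \<gamma> \<beta> (Branch a s)"
      using le by (rule coeff_le_trans)
    then show ?thesis using ks ls sum len height False
      by (intro exI[of _ ?ks]) auto
  qed
qed

text \<open>For \<gamma> = 1 and \<beta> = 0 the context polynomial is \<open>B\<close> itself, and
  such a context dominates paths of every length, so the position of the root does not
  matter.\<close>

lemma root_poly_collapse:
  "\<exists>ks. sum_list ks = num_edges t \<and> length ks = num_leaves t \<and> root_poly (star_tree ks) \<le>\<^sub>p root_poly t"
proof -
  have "dominates_paths (tree_height t) 1 0" by (auto simp: dominates_paths_def)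
  from collapse[OF this, of t] show ?thesis by (auto simp: context_poly_def)
qed

lemma full_poly_reroot: "full_poly (Branch t s) = full_poly (Branch s t)"
  by (simp add: full_poly_def algebra_simps)

text \<open>Children are ordered in the datatype; a deepest one is brought to the front while
  everything that does not depend on the order is kept. The last conjunct ensures that a remainder
  survives if the root had a second child.\<close>

lemma deepest_child_first:
  assumes "t \<noteq> Root"
  shows "\<exists>c r. root_poly t = root_poly (Branch c r) \<and> nonroot_poly t = nonroot_poly (Branch c r)
    \<and> num_edges t = num_edges (Branch c r) \<and> num_leaves t = num_leaves (Branch c r)
    \<and> tree_height t = Suc (tree_height c) \<and> tree_height r \<le> tree_height t
    \<and> (r = Root \<longrightarrow> (\<exists>a. t = Branch a Root))"
  using assms
proof (induction t)
  case (Branch a b)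
  show ?case
  proof (cases "tree_height b \<le> Suc (tree_height a)")
    case True
    then show ?thesis by (intro exI[of _ a] exI[of _ b]) auto
  next
    case False
    then have "b \<noteq> Root" by auto
    from Branch.IH(2)[OF this] obtain c r where
      cr: "root_poly b = root_poly (Branch c r)" "nonroot_poly b = nonroot_poly (Branch c r)"
        "num_edges b = num_edges (Branch c r)" "num_leaves b = num_leaves (Branch c r)"
        "tree_height b = Suc (tree_height c)" "tree_height r \<le> tree_height b"
      by blast
    show ?thesis
      using cr False
      by (intro exI[of _ c] exI[of _ "Branch a r"])
        (auto simp: algebra_simps)
  qed
qed auto

text \<open>The branch with child \<open>c\<close> and the tree \<open>r\<close> share the root, and
  each is deep enough to serve as the dominating surroundings while the other is collapsed.\<close>

lemma full_poly_collapse_central: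
  assumes "tree_height r \<le> Suc (tree_height c)" "tree_height c \<le> tree_height r"
  shows "\<exists>ks. sum_list ks = num_edges (Branch c r) \<and> length ks = num_leaves (Branch c r)
    \<and> full_poly (star_tree ks) \<le>\<^sub>p full_poly (Branch c r)"
proof -
  let ?p = "Branch c Root"
  have glue_p: "glue ?p r = Branch c r" by simp
  have ctx: "context_poly (nonroot_poly t) (root_poly t) s = full_poly (glue t s)"
    "context_poly (nonroot_poly t) (root_poly t) s = full_poly (glue s t)" for t s
    by (simp_all add: context_poly_def full_poly_def algebra_simps)
  have "dominates_paths (tree_height ?p) (nonroot_poly ?p) (root_poly ?p)"
    by (rule dominates_paths_tree)
  from collapse[OF this, of r] assms obtain ks where
    ks: "sum_list ks = num_edges r" "length ks = num_leaves r"
      "tree_height (star_tree ks) = tree_height r"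
      "full_poly (glue ?p (star_tree ks)) \<le>\<^sub>p full_poly (glue ?p r)"
    unfolding ctx(1) by auto
  \<comment> \<open>Collapsing \<open>r\<close> kept its height, so the resulting starlike tree
    still dominates as far as \<open>r\<close> did.\<close>
  have "dominates_paths (tree_height (star_tree ks)) (nonroot_poly (star_tree ks)) (root_poly (star_tree ks))"
    by (rule dominates_paths_tree)
  from collapse[OF this, of ?p] assms ks(3) obtain ls where
    ls: "sum_list ls = num_edges ?p" "length ls = num_leaves ?p"
      "full_poly (glue (star_tree ls) (star_tree ks)) \<le>\<^sub>p full_poly (glue ?p (star_tree ks))"
    unfolding ctx(2) by auto
  have "full_poly (star_tree (ls @ ks)) \<le>\<^sub>p full_poly (Branch c r)"
    using coeff_le_trans[OF ls(3) ks(4)] by (simp add: star_tree_append)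
  then show ?thesis using ks(1,2) ls(1,2) by (intro exI[of _ "ls @ ks"]) auto
qed

text \<open>The tree is first rerooted at its center, so that two branches have almost the same height.\<close>

lemma full_poly_collapse:
  assumes "s \<noteq> Root"
  shows "\<exists>ks. sum_list ks = num_edges (Branch t s) \<and> length ks = num_leaves (Branch t s)
    \<and> full_poly (star_tree ks) \<le>\<^sub>p full_poly (Branch t s)"
  using assms
proof (induction "tree_height (Branch t s)" arbitrary: t s rule: less_induct)
  case less
  obtain c r where cr: "root_poly (Branch t s) = root_poly (Branch c r)"
      "nonroot_poly (Branch t s) = nonroot_poly (Branch c r)"
      "num_edges (Branch t s) = num_edges (Branch c r)"
      "num_leaves (Branch t s) = num_leaves (Branch c r)"
      "tree_height (Branch t s) = Suc (tree_height c)" "tree_height r \<le> tree_height (Branch t s)"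
      "r \<noteq> Root"
    using deepest_child_first[of "Branch t s"] less.prems by blast
  have full: "full_poly (Branch t s) = full_poly (Branch c r)"
    using cr(1,2) by (simp only: full_poly_def)
  show ?case
  proof (cases "tree_height c \<le> tree_height r")
    case True
    then show ?thesis
      using full_poly_collapse_central[of r c] cr full by simp
  next
    case False
    \<comment> \<open>The root moves to the deepest child. The new height is below
      \<open>Suc (tree_height c)\<close> because \<open>r\<close> is lower than \<open>c\<close>,
      and the leaf count is kept since neither end of the edge is a leaf.\<close>
    have "c \<noteq> Root" using False tree_height_eq_0[of c] by auto
    moreover have "tree_height (Branch r c) < tree_height (Branch t s)"
      using False unfolding cr(5) by simp
    ultimately obtain ks where "sum_list ks = num_edges (Branch r c)"
      "length ks = num_leaves (Branch r c)" "full_poly (star_tree ks) \<le>\<^sub>p full_poly (Branch r c)"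
      using less.hyps by blast
    then show ?thesis
      unfolding full cr(3,4) full_poly_reroot[of c r]
      using \<open>c \<noteq> Root\<close> cr(7) by (intro exI[of _ ks]) auto
  qed
qed

section \<open>Balancing a starlike tree\<close>

definition balanced :: "nat list \<Rightarrow> bool" where
  "balanced ks \<longleftrightarrow> (\<forall>x \<in> set ks. \<forall>y \<in> set ks. x \<le> Suc y)"

text \<open>Only the minimum \<open>k\<close> and \<open>Suc k\<close> occur, and \<open>k\<close>
  does occur, so fewer than \<open>length ks\<close> entries are \<open>Suc k\<close>. Division with
  remainder then recovers \<open>k\<close> and this number from the sum, so length and sum determine
  the multiset.\<close>

lemma balanced_mset:
  assumes "balanced ks" "ks \<noteq> []"
  defines "q \<equiv> sum_list ks div length ks" and "r \<equiv> sum_list ks mod length ks"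
  shows "mset ks = replicate_mset r (Suc q) + replicate_mset (length ks - r) q"
proof -
  define k where "k = Min (set ks)"
  have k: "k \<in> set ks" using assms unfolding k_def by simp
  have sub: "set ks \<subseteq> {k, Suc k}"
  proof
    fix x assume x: "x \<in> set ks"
    have "k \<le> x" using x unfolding k_def by simp
    moreover have "x \<le> Suc k" using assms(1) x k by (auto simp: balanced_def)
    ultimately show "x \<in> {k, Suc k}" by auto
  qed
  define d where "d = count_list ks (Suc k)"
  have *: "sum_list xs = k * length xs + count_list xs (Suc k) \<and> count_list xs (Suc k) \<le> length xs
      \<and> mset xs = replicate_mset (count_list xs (Suc k)) (Suc k)
         + replicate_mset (length xs - count_list xs (Suc k)) k"
    if "set xs \<subseteq> {k, Suc k}" for xs
    using that by (induction xs) (auto simp: Suc_diff_le)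
  have "d < length ks"
    using k unfolding d_def
  proof (induction ks)
    case (Cons a as)
    have "count_list as (Suc k) \<le> length as" by (simp add: count_le_length)
    with Cons show ?case by auto
  qed auto
  then have "k = q" "d = r"
    using *[OF sub] assms(2) unfolding q_def r_def d_def by simp_all
  then show ?thesis using *[OF sub] unfolding d_def by simp
qed

text \<open>Two paths at the root form a single path with \<open>p + q\<close> edges, and
  \<open>A\<close> does not see where its root lies; this is \<open>a\<close>. The products of the
  \<open>B\<close> differ by the cross difference of \<open>path_poly_cross\<close>; this is
  \<open>b\<close>.\<close>

lemma smooth_pair:
  assumes "nonneg_poly \<gamma>" "nonneg_poly \<beta>" "Suc (Suc q) \<le> p"
  shows "context_poly \<gamma> \<beta> (star_tree ((p - 1) # Suc q # ks))
     \<le>\<^sub>p context_poly \<gamma> \<beta> (star_tree (p # q # ks))"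
proof -
  obtain d where p: "p = Suc (Suc (d + q))"
    using assms(3) by (metis add.commute add_Suc_right le_Suc_ex)
  have "path_nonroot_poly (Suc d + q) * path_root_poly q - path_root_poly (Suc d + q) * path_nonroot_poly q
     = path_nonroot_poly (Suc d)"
    by (rule path_poly_cross)
  then have cross: "path_nonroot_poly (Suc d + q) * path_root_poly q
      = path_root_poly (Suc d + q) * path_nonroot_poly q + path_nonroot_poly (Suc d)"
    by (simp add: algebra_simps)
  let ?w = "root_poly (star_tree ks)" and ?w' = "nonroot_poly (star_tree ks)"
  have b: "path_root_poly p * path_root_poly q
      = path_root_poly (Suc d + q) * path_root_poly (Suc q) + path_nonroot_poly (Suc d)"
    using cross unfolding p by (simp add: algebra_simps)
  have a: "X * (path_root_poly p * path_root_poly q) + path_nonroot_poly p * path_root_poly q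
        + path_root_poly p * path_nonroot_poly q
      = X * (path_root_poly (Suc d + q) * path_root_poly (Suc q))
        + path_nonroot_poly (Suc d + q) * path_root_poly (Suc q)
        + path_root_poly (Suc d + q) * path_nonroot_poly (Suc q)"
    unfolding p by (simp add: algebra_simps)
  have expand: "context_poly \<gamma> \<beta> (star_tree (m # n # ks)) = 
      (\<gamma> * ?w + \<beta> * ?w') * (path_root_poly m * path_root_poly n) + \<beta> * ?w *
       (X * (path_root_poly m * path_root_poly n) + path_nonroot_poly m * path_root_poly n
        + path_root_poly m * path_nonroot_poly n)" for m n
    by (simp add: context_poly_def full_poly_def algebra_simps)
  have p1: "p - 1 = Suc d + q" by (simp add: p)
  have "context_poly \<gamma> \<beta> (star_tree (p # q # ks)) - context_poly \<gamma> \<beta> (star_tree ((p - 1) # Suc q # ks))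
    = (\<gamma> * ?w + \<beta> * ?w') * (path_root_poly p * path_root_poly q
        - path_root_poly (Suc d + q) * path_root_poly (Suc q))"
    unfolding expand p1 a by (simp only: algebra_simps)
  also have "\<dots> = (\<gamma> * ?w + \<beta> * ?w') * path_nonroot_poly (Suc d)"
    unfolding b by simp
  finally have "context_poly \<gamma> \<beta> (star_tree (p # q # ks))
      - context_poly \<gamma> \<beta> (star_tree ((p - 1) # Suc q # ks))
    = (\<gamma> * ?w + \<beta> * ?w') * path_nonroot_poly (Suc d)" .
  moreover have "nonneg_poly ((\<gamma> * ?w + \<beta> * ?w') * path_nonroot_poly (Suc d))"
    using assms by (intro nonneg_poly_mult nonneg_poly_add) auto
  ultimately show ?thesis by simp
qed

text \<open>Passing one edge from a path of length \<open>p\<close> to one of length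
  \<open>q\<close>, where \<open>p > q + 1\<close>, lowers the sum of squares by
  \<open>2 (p - q - 1)\<close>, which makes the smoothing terminate.\<close>

lemma balanced_minimal:
  assumes "nonneg_poly \<gamma>" "nonneg_poly \<beta>" "balanced ks" "length ks = length ls" "sum_list ks = sum_list ls"
  shows "context_poly \<gamma> \<beta> (star_tree ks) \<le>\<^sub>p context_poly \<gamma> \<beta> (star_tree ls)"
  using assms(4,5)
proof (induction "sum_list (map (\<lambda>k. k * k) ls)" arbitrary: ls rule: less_induct)
  case less
  have eq_if: "context_poly \<gamma> \<beta> (star_tree xs) = context_poly \<gamma> \<beta> (star_tree ys)"
    if "mset xs = mset ys" for xs ys
    using star_tree_mset[OF that] by (simp add: context_poly_def full_poly_def)
  show ?case
  proof (cases "balanced ls")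
    case True
    have "mset ks = mset ls"
    proof (cases "ls = []")
      case False
      then have "ks \<noteq> []" using less.prems by auto
      show ?thesis
        unfolding balanced_mset[OF assms(3) \<open>ks \<noteq> []\<close>] balanced_mset[OF True False] less.prems ..
    qed (use less.prems in simp)
    then have "context_poly \<gamma> \<beta> (star_tree ks) = context_poly \<gamma> \<beta> (star_tree ls)"
      by (rule eq_if)
    then show ?thesis by simp
  next
    case False
    then obtain p q where pq: "p \<in> set ls" "q \<in> set ls" "Suc q < p"
      by (auto simp: balanced_def not_le)
    obtain ys zs where ls: "ls = ys @ p # zs" using pq(1) by (meson split_list)
    then have "q \<in> set (ys @ zs)" using pq by auto
    then obtain us vs where "ys @ zs = us @ q # vs" by (meson split_list)
    then have "mset ys + mset zs = mset us + add_mset q (mset vs)"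
      by (metis mset_append mset.simps(2))
    then have ms: "mset ls = mset (p # q # us @ vs)" unfolding ls by simp
    define rest where "rest = us @ vs"
    note ms = ms[folded rest_def]
    have sum: "sum_list (map f ls) = f p + f q + sum_list (map f rest)" for f :: "nat \<Rightarrow> nat"
      using arg_cong[OF ms, of "\<lambda>M. sum_mset (image_mset f M)"]
      by (simp only: mset_map[symmetric] sum_mset_sum_list) simp
    have len: "length ls = Suc (Suc (length rest))"
      using arg_cong[OF ms, of size] by (simp only: size_mset) simp
    let ?ls = "(p - 1) # Suc q # rest"
    obtain d where p: "p = Suc (Suc (d + q))"
      using pq(3) by (metis add.commute add_Suc_right less_iff_Suc_add)
    have 1: "context_poly \<gamma> \<beta> (star_tree ks) \<le>\<^sub>p context_poly \<gamma> \<beta> (star_tree ?ls)"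
    proof (rule less.hyps)
      show "sum_list (map (\<lambda>k. k * k) ?ls) < sum_list (map (\<lambda>k. k * k) ls)"
        unfolding sum[of "\<lambda>k. k * k"] by (simp add: p algebra_simps)
      show "length ks = length ?ls" using len less.prems by simp
      show "sum_list ks = sum_list ?ls" using sum[of "\<lambda>k. k"] less.prems p by simp
    qed
    have 2: "context_poly \<gamma> \<beta> (star_tree ?ls) \<le>\<^sub>p context_poly \<gamma> \<beta> (star_tree (p # q # rest))"
      using assms(1,2) pq(3) by (intro smooth_pair) auto
    have 3: "context_poly \<gamma> \<beta> (star_tree (p # q # rest)) = context_poly \<gamma> \<beta> (star_tree ls)"
      by (rule eq_if) (simp add: ms)
    show ?thesis using coeff_le_trans[OF 1 2] unfolding 3 .
  qed
qed

lemma balanced_star_minimal: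
  assumes "s \<noteq> Root" "balanced ks" "length ks = num_leaves (Branch t s)"
    "sum_list ks = num_edges (Branch t s)"
  shows "root_poly (star_tree ks) \<le>\<^sub>p root_poly (Branch t s)"
    and "full_poly (star_tree ks) \<le>\<^sub>p full_poly (Branch t s)"
proof -
  obtain ls where ls: "sum_list ls = num_edges (Branch t s)" "length ls = num_leaves (Branch t s)"
      "root_poly (star_tree ls) \<le>\<^sub>p root_poly (Branch t s)"
    using root_poly_collapse by blast
  have "root_poly (star_tree ks) \<le>\<^sub>p root_poly (star_tree ls)"
    using balanced_minimal[of 1 0 ks ls] assms ls by (simp add: context_poly_def)
  then show "root_poly (star_tree ks) \<le>\<^sub>p root_poly (Branch t s)"
    using ls(3) by (rule coeff_le_trans)
  obtain ls where ls: "sum_list ls = num_edges (Branch t s)" "length ls = num_leaves (Branch t s)"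
      "full_poly (star_tree ls) \<le>\<^sub>p full_poly (Branch t s)"
    using full_poly_collapse[OF assms(1)] by blast
  have "full_poly (star_tree ks) \<le>\<^sub>p full_poly (star_tree ls)"
    using balanced_minimal[of 0 1 ks ls] assms ls by (simp add: context_poly_def)
  then show "full_poly (star_tree ks) \<le>\<^sub>p full_poly (Branch t s)"
    using ls(3) by (rule coeff_le_trans)
qed

section \<open>Determinants indexed by finite sets\<close>

text \<open>Indexing by a set lets principal minors arise by shrinking \<open>S\<close>, with the
  entries left untouched.\<close>

definition set_det :: "'a set \<Rightarrow> ('a \<Rightarrow> 'a \<Rightarrow> 'r :: idom) \<Rightarrow> 'r" where
  "set_det S f = (\<Sum>p | p permutes S. of_int (sign p) * (\<Prod>i\<in>S. f i (p i)))"

lemma set_det_empty [simp]: "set_det {} f = 1"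
  by (simp add: set_det_def)

lemma set_det_cong:
  assumes "\<And>x y. x \<in> S \<Longrightarrow> y \<in> S \<Longrightarrow> f x y = g x y"
  shows "set_det S f = set_det S g"
  unfolding set_det_def
  by (intro sum.cong prod.cong refl arg_cong2[where f = "(*)"] assms)
    (auto simp: permutes_in_image)

lemma set_det_reindex:
  assumes h: "bij_betw h A B" and fin: "finite A"
  shows "set_det B f = set_det A (\<lambda>x y. f (h x) (h y))"
  unfolding set_det_def
proof (rule sum.reindex_bij_witness[where i = "map_permutation A h"
      and j = "map_permutation B (inv_into A h)"])
  have inj: "inj_on h A" and h': "bij_betw (inv_into A h) B A"
    using h bij_betw_inv_into[OF h] by (auto simp: bij_betw_def)
  have inv: "h (inv_into A h x) = x" if "x \<in> B" for x
    using h that by (auto simp: bij_betw_def f_inv_into_f)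
  have inv': "inv_into A h (h x) = x" if "x \<in> A" for x
    using inj that by simp
  fix p assume "p \<in> {p. p permutes B}"
  then have p: "p permutes B" by simp
  let ?q = "map_permutation B (inv_into A h) p"
  show "map_permutation A h ?q = p"
    by (rule map_permutation_compose_inv[OF h' p]) (rule inv)
  show q: "?q \<in> {p. p permutes A}"
    using map_permutation_permutes[OF h' p] by simp
  have s: "sign ?q = sign p"
    using h' p fin h bij_betw_finite[OF h] by (intro sign_map_permutation) (auto simp: bij_betw_def)
  have "(\<Prod>i\<in>B. f i (p i)) = (\<Prod>i\<in>A. f (h i) (p (h i)))"
    using prod.reindex_bij_betw[OF h, of "\<lambda>i. f i (p i)"] by simp
  also have "\<dots> = (\<Prod>i\<in>A. f (h i) (h (?q i)))"
  proof (intro prod.cong refl)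
    fix i assume i: "i \<in> A"
    then have hi: "h i \<in> B" using h by (auto simp: bij_betw_def)
    have "?q i = inv_into A h (p (h i))"
      using map_permutation_apply[of "inv_into A h" B "h i" p] h' hi inv'[OF i]
      by (auto simp: bij_betw_def)
    then show "f (h i) (p (h i)) = f (h i) (h (?q i))"
      using inv[of "p (h i)"] hi p by (simp add: permutes_in_image)
  qed
  finally show "of_int (sign ?q) * (\<Prod>i\<in>A. f (h i) (h (?q i))) = of_int (sign p) * (\<Prod>i\<in>B. f i (p i))"
    unfolding s by simp
next
  have inj: "inj_on h A" and h': "bij_betw (inv_into A h) B A"
    using h bij_betw_inv_into[OF h] by (auto simp: bij_betw_def)
  fix p assume "p \<in> {p. p permutes A}"
  then have p: "p permutes A" by simp
  show "map_permutation B (inv_into A h) (map_permutation A h p) = p"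
    by (rule map_permutation_compose_inv[OF h p]) (use inj in simp)
  show "map_permutation A h p \<in> {p. p permutes B}"
    using map_permutation_permutes[OF h p] by simp
qed

lemma set_det_list:
  assumes "distinct xs" "set xs = S"
  shows "set_det S f = det (mat (length xs) (length xs) (\<lambda>(i, j). f (xs ! i) (xs ! j)))"
proof -
  have "bij_betw (nth xs) {0..<length xs} S"
    using assms bij_betw_nth[of xs "{0..<length xs}" S] by (auto simp: atLeast0LessThan)
  then have "set_det S f = set_det {0..<length xs} (\<lambda>i j. f (xs ! i) (xs ! j))"
    by (rule set_det_reindex) simp
  also have "\<dots> = det (mat (length xs) (length xs) (\<lambda>(i, j). f (xs ! i) (xs ! j)))"
    by (subst det_def', rule mat_carrier)
      (auto simp: set_det_def permutes_in_image intro!: sum.cong prod.cong)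
  finally show ?thesis .
qed

lemma set_det_block:
  assumes fin: "finite S" "finite T" and disj: "S \<inter> T = {}"
    and zero: "\<And>x y. x \<in> S \<Longrightarrow> y \<in> T \<Longrightarrow> f x y = 0"
  shows "set_det (S \<union> T) f = set_det S f * set_det T f"
proof -
  obtain xs where xs: "distinct xs" "set xs = S" using finite_distinct_list fin by blast
  obtain ys where ys: "distinct ys" "set ys = T" using finite_distinct_list fin by blast
  let ?n = "length xs" and ?m = "length ys"
  let ?M = "\<lambda>as bs. mat (length as) (length bs) (\<lambda>(i, j). f (as ! i) (bs ! j))"
  have "set_det (S \<union> T) f = det (?M (xs @ ys) (xs @ ys))"
    using xs ys disj by (intro set_det_list) auto
  also have "?M (xs @ ys) (xs @ ys) = four_block_mat (?M xs xs) (?M xs ys) (?M ys xs) (?M ys ys)"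
    by (intro eq_matI) (auto simp: nth_append)
  also have "det \<dots> = det (?M xs xs) * det (?M ys ys)"
  proof (rule det_four_block_mat_upper_right_zero[of _ ?n _ ?m])
    show "?M xs ys = 0\<^sub>m ?n ?m"
      using xs ys zero by (intro eq_matI) auto
  qed auto
  also have "\<dots> = set_det S f * set_det T f"
    using set_det_list[OF xs] set_det_list[OF ys] by metis
  finally show ?thesis .
qed

section \<open>Expansion of a determinant along one row\<close>

lemma set_det_row:
  assumes "finite S" "i \<in> S"
  shows "set_det S (f(i := r)) = (\<Sum>p | p permutes S. of_int (sign p) * (r (p i) * (\<Prod>x\<in>S-{i}. f x (p x))))"
  unfolding set_det_def
  using assms by (intro sum.cong refl) (simp add: prod.remove[of S i])

lemma set_det_row_add:
  assumes "finite S" "i \<in> S"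
  shows "set_det S (f(i := \<lambda>y. r y + c * s y)) = set_det S (f(i := r)) + c * set_det S (f(i := s))"
  by (simp add: set_det_row[OF assms] algebra_simps sum.distrib sum_distrib_left)

lemma set_det_row_sum:
  assumes "finite S" "i \<in> S" "finite I"
  shows "set_det S (f(i := \<lambda>y. \<Sum>a\<in>I. c a * s a y)) = (\<Sum>a\<in>I. c a * set_det S (f(i := s a)))"
  using assms(3)
proof (induction I)
  case empty
  then show ?case by (simp only: set_det_row[OF assms(1,2)] sum.empty) simp
next
  case (insert a I)
  have eq: "(\<lambda>y. \<Sum>a\<in>insert a I. c a * s a y) = (\<lambda>y. (\<Sum>a\<in>I. c a * s a y) + c a * s a y)"
    using insert by (auto simp: add.commute)
  show ?case
    unfolding eq unfolding set_det_row_add[OF assms(1,2)] insert.IH sum.insert[OF insert.hyps]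
    by (rule add.commute)
qed

lemma set_det_unit_row:
  assumes "finite S" "i \<in> S"
  shows "set_det S (f(i := \<lambda>y. if y = i then 1 else 0)) = set_det (S - {i}) f"
proof -
  let ?g = "f(i := \<lambda>y. if y = i then 1 else 0)"
  have "set_det ({i} \<union> (S - {i})) ?g = set_det {i} ?g * set_det (S - {i}) ?g"
    using assms by (intro set_det_block) auto
  moreover have "{i} \<union> (S - {i}) = S" using assms by auto
  moreover have "set_det {i} ?g = 1" by (simp add: set_det_def)
  moreover have "set_det (S - {i}) ?g = set_det (S - {i}) f"
    by (rule set_det_cong) auto
  ultimately show ?thesis by simp
qed

lemma set_det_diag_add:
  assumes "finite S" "i \<in> S"
  shows "set_det S (f(i := \<lambda>y. f i y + (if y = i then c else 0)))
    = set_det S f + c * set_det (S - {i}) f"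
  using set_det_row_add[OF assms, of f "f i" c "\<lambda>y. if y = i then 1 else 0"]
    set_det_unit_row[OF assms, of f]
  by (simp add: if_distrib cong: if_cong)

text \<open>After index \<open>i\<close> is deleted, column \<open>j\<close> has absorbed column
  \<open>i\<close>, so the remaining rows keep their sums.\<close>

definition merge_column :: "'a \<Rightarrow> 'a \<Rightarrow> ('a \<Rightarrow> 'a \<Rightarrow> 'r :: idom) \<Rightarrow> 'a \<Rightarrow> 'a \<Rightarrow> 'r" where
  "merge_column i j f = (\<lambda>x y. if y = j then f x j + f x i else f x y)"

lemma set_det_merge_column:
  assumes "finite S" "i \<in> S" "j \<in> S" "i \<noteq> j"
  shows "set_det S (merge_column i j f) = set_det S f"
proof -
  obtain xs where xs: "distinct xs" "set xs = S" using finite_distinct_list assms(1) by blast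
  obtain k l where kl: "k < length xs" "xs ! k = j" "l < length xs" "xs ! l = i"
    using assms xs by (metis in_set_conv_nth)
  let ?A = "mat (length xs) (length xs) (\<lambda>(i, j). f (xs ! i) (xs ! j))"
  have "mat (length xs) (length xs) (\<lambda>(a, b). merge_column i j f (xs ! a) (xs ! b)) = addcol 1 k l ?A"
    using kl xs assms(4)
    by (intro eq_matI) (auto simp: merge_column_def mat_addcol_def nth_eq_iff_index_eq)
  moreover have "det (addcol 1 k l ?A) = det ?A"
    using kl assms(4) by (intro det_addcol[of _ "length xs"]) auto
  ultimately show ?thesis by (simp add: set_det_list[OF xs])
qed

text \<open>Adding column \<open>i\<close> to column \<open>j\<close> turns the row with 1 at
  \<open>i\<close> and -1 at \<open>j\<close> into a unit row.\<close>

lemma set_det_difference_row: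
  assumes "finite S" "i \<in> S" "j \<in> S" "i \<noteq> j"
  shows "set_det S (f(i := \<lambda>y. (if y = i then 1 else 0) - (if y = j then 1 else 0)))
     = set_det (S - {i}) (merge_column i j f)"
proof -
  let ?g = "f(i := \<lambda>y. (if y = i then 1 else 0) - (if y = j then 1 else 0))"
  have "set_det S ?g = set_det S (merge_column i j ?g)"
    by (rule set_det_merge_column[OF assms, symmetric])
  also have "merge_column i j ?g = (merge_column i j f)(i := \<lambda>y. if y = i then 1 else 0)"
    using assms(4) by (auto simp: merge_column_def fun_eq_iff)
  also have "set_det S \<dots> = set_det (S - {i}) (merge_column i j f)"
    by (rule set_det_unit_row[OF assms(1,2)])
  finally show ?thesis .
qed

lemma set_det_row_add_difference:
  assumes "finite S" "i \<in> S" "j \<in> S" "i \<noteq> j"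
  shows "set_det S (f(i := \<lambda>y. f i y + ((if y = i then 1 else 0) - (if y = j then 1 else 0))))
     = set_det S f + set_det (S - {i}) (merge_column i j f)"
  using set_det_row_add[OF assms(1,2), of f "f i" 1 "\<lambda>y. (if y = i then 1 else 0) - (if y = j then 1 else 0)"]
    set_det_difference_row[OF assms, of f]
  by simp

text \<open>
  Row \<open>i\<close> is its row sum times the unit row plus a nonnegative combination of differences
  \<open>e\<^sub>i - e\<^sub>j\<close>; expanding along it expresses the determinant through matrices of the same kind on one
  index less.
\<close>

lemma set_det_nonneg:
  fixes f :: "'a \<Rightarrow> 'a \<Rightarrow> real poly"
  assumes "finite S"
    and "\<And>x. x \<in> S \<Longrightarrow> nonneg_poly (\<Sum>y\<in>S. f x y)"
    and "\<And>x y. x \<in> S \<Longrightarrow> y \<in> S \<Longrightarrow> x \<noteq> y \<Longrightarrow> nonneg_poly (- f x y)"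
  shows "nonneg_poly (set_det S f)
    \<and> ((\<forall>x\<in>S. 0 < poly (\<Sum>y\<in>S. f x y) 1) \<longrightarrow> 0 < poly (set_det S f) 1)"
  using assms
proof (induction "card S" arbitrary: S f)
  case 0
  then show ?case by simp
next
  case (Suc n)
  then obtain i where i: "i \<in> S" by fastforce
  let ?S = "S - {i}"
  define d where "d = (\<Sum>y\<in>S. f i y)"
  let ?e = "\<lambda>a y. if y = a then 1 else (0 :: real poly)"
  have sumS: "(\<Sum>y\<in>S. h y) = h i + (\<Sum>y\<in>?S. h y)" for h :: "'a \<Rightarrow> real poly"
    using i Suc.prems(1) by (rule sum.remove[rotated])
  have "set_det S f = set_det S (f(i := \<lambda>y. d * ?e i y + 1 * (\<Sum>j\<in>?S. - f i j * (?e i y - ?e j y))))"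
  proof (rule set_det_cong)
    fix x y assume xy: "x \<in> S" "y \<in> S"
    have "d * ?e i y + 1 * (\<Sum>j\<in>?S. - f i j * (?e i y - ?e j y)) = f i y"
    proof (cases "y = i")
      case True
      have "(\<Sum>j\<in>?S. - f i j * (?e i i - ?e j i)) = - (\<Sum>j\<in>?S. f i j)"
        unfolding sum_negf[symmetric] by (rule sum.cong) auto
      then show ?thesis using True by (simp add: d_def sumS)
    next
      case False
      have "(\<Sum>j\<in>?S. - f i j * (?e i y - ?e j y)) = (\<Sum>j\<in>?S. if j = y then f i j else 0)"
        using False by (intro sum.cong) auto
      also have "\<dots> = f i y" using False xy Suc.prems(1) by simp
      finally show ?thesis using False by simp
    qed
    then show "f x y = (f(i := \<lambda>y. d * ?e i y + 1 * (\<Sum>j\<in>?S. - f i j * (?e i y - ?e j y)))) x y"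
      by simp
  qed
  also have "\<dots> = set_det S (f(i := \<lambda>y. d * ?e i y))
      + 1 * set_det S (f(i := \<lambda>y. \<Sum>j\<in>?S. - f i j * (?e i y - ?e j y)))"
    by (rule set_det_row_add[OF Suc.prems(1) i])
  also have "set_det S (f(i := \<lambda>y. d * ?e i y)) = d * set_det ?S f"
    using set_det_row_sum[OF Suc.prems(1) i, of "{i}" f "\<lambda>_. d" "\<lambda>_. ?e i"]
      set_det_unit_row[OF Suc.prems(1) i, of f] by simp
  also have "set_det S (f(i := \<lambda>y. \<Sum>j\<in>?S. - f i j * (?e i y - ?e j y)))
      = (\<Sum>j\<in>?S. - f i j * set_det S (f(i := \<lambda>y. ?e i y - ?e j y)))"
    by (rule set_det_row_sum[OF Suc.prems(1) i]) (use Suc.prems(1) in simp)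
  also have "\<dots> = (\<Sum>j\<in>?S. - f i j * set_det ?S (merge_column i j f))"
    using i Suc.prems(1) by (intro sum.cong refl) (auto simp: set_det_difference_row)
  finally have expand: "set_det S f = d * set_det ?S f + (\<Sum>j\<in>?S. - f i j * set_det ?S (merge_column i j f))"
    by simp
  have n: "n = card ?S" "finite ?S" using Suc.hyps(2) Suc.prems(1) i by auto
  \<comment> \<open>Dropping column \<open>i\<close> removes an entry with nonpositive coefficients
    from each remaining row, so row sums can only grow.\<close>
  have IH1: "nonneg_poly (set_det ?S f)
      \<and> ((\<forall>x\<in>?S. 0 < poly (\<Sum>y\<in>?S. f x y) 1) \<longrightarrow> 0 < poly (set_det ?S f) 1)"
  proof (rule Suc.hyps(1)[OF n])
    fix x assume x: "x \<in> ?S"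
    have "(\<Sum>y\<in>?S. f x y) = (\<Sum>y\<in>S. f x y) + - f x i" by (simp add: sumS)
    then show "nonneg_poly (\<Sum>y\<in>?S. f x y)"
      using x i Suc.prems(2,3) by (simp only:) (intro nonneg_poly_add, auto)
  qed (use Suc.prems in auto)
  \<comment> \<open>Merging restores the dropped entry in column \<open>j\<close>: row sums over
    \<open>?S\<close> equal those over \<open>S\<close>, and off-diagonal entries keep their
    sign.\<close>
  have IH2: "nonneg_poly (set_det ?S (merge_column i j f))" if j: "j \<in> ?S" for j
  proof (rule conjunct1[OF Suc.hyps(1)[OF n]])
    fix x assume x: "x \<in> ?S"
    have "(\<Sum>y\<in>?S. merge_column i j f x y) = (\<Sum>y\<in>?S. f x y + (if y = j then f x i else 0))"
      by (intro sum.cong) (auto simp: merge_column_def)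
    also have "\<dots> = (\<Sum>y\<in>S. f x y)"
      using j n(2) by (simp add: sum.distrib sumS add.commute)
    finally show "nonneg_poly (\<Sum>y\<in>?S. merge_column i j f x y)"
      using x Suc.prems(2) by simp
  next
    fix x y assume "x \<in> ?S" "y \<in> ?S" "x \<noteq> y"
    then have "nonneg_poly (- f x y)" "nonneg_poly (- f x i)"
      using Suc.prems(3) i by auto
    then show "nonneg_poly (- merge_column i j f x y)"
      using nonneg_poly_add[of "- f x y" "- f x i"] by (auto simp: merge_column_def)
  qed
  have rest: "nonneg_poly (\<Sum>j\<in>?S. - f i j * set_det ?S (merge_column i j f))"
    using IH2 Suc.prems(3) i by (intro nonneg_poly_sum nonneg_poly_mult) auto
  have "nonneg_poly d" using Suc.prems(2) i by (simp add: d_def)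
  then have "nonneg_poly (set_det S f)"
    unfolding expand using IH1 rest by (auto intro!: nonneg_poly_add nonneg_poly_mult)
  moreover have "0 < poly (set_det S f) 1" if pos: "\<forall>x\<in>S. 0 < poly (\<Sum>y\<in>S. f x y) 1"
  proof -
    have "0 < poly (\<Sum>y\<in>?S. f x y) 1" if x: "x \<in> ?S" for x
    proof -
      have "(\<Sum>y\<in>?S. f x y) = (\<Sum>y\<in>S. f x y) + - f x i" by (simp add: sumS)
      moreover have "0 \<le> poly (- f x i) 1"
        using x i Suc.prems(3) by (intro nonneg_poly_poly) auto
      ultimately show ?thesis using pos x by (simp only: poly_add) (auto intro: add_pos_nonneg)
    qed
    then have "0 < poly (set_det ?S f) 1" using IH1 by blast
    moreover have "0 < poly d 1" using pos i by (simp add: d_def)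
    ultimately show ?thesis
      unfolding expand poly_add poly_mult
      using nonneg_poly_poly[OF rest, of 1] by (auto intro!: add_pos_nonneg mult_pos_pos)
  qed
  ultimately show ?case by blast
qed

section \<open>Two parts of a graph joined by a bridge\<close>

definition edge_laplacian :: "'a \<Rightarrow> 'a \<Rightarrow> 'a \<Rightarrow> 'a \<Rightarrow> 'r :: idom" where
  "edge_laplacian r v x y =
     (if x = y then (if x = r \<or> x = v then 1 else 0)
      else if (x, y) \<in> {(r, v), (v, r)} then -1 else 0)"

text \<open>Row \<open>r\<close> is split into its part without the edge and the edge contribution.
  Without the edge in row \<open>r\<close>, the rows of \<open>S\<close> vanish on \<open>V\<close>,
  and the edge survives only as 1 on the diagonal at \<open>v\<close>. With the contribution alone,
  merging column \<open>r\<close> into column \<open>v\<close> cancels the edge in row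
  \<open>v\<close>, and the rows of \<open>V\<close> vanish on \<open>S - {r}\<close>.\<close>

lemma set_det_bridge:
  assumes fin: "finite S" "finite V" and disj: "S \<inter> V = {}" and rv: "r \<in> S" "v \<in> V"
    and zero: "\<And>x y. x \<in> S \<Longrightarrow> y \<in> V \<Longrightarrow> f x y = 0 \<and> f y x = 0"
  shows "set_det (S \<union> V) (\<lambda>x y. f x y + edge_laplacian r v x y)
    = set_det S f * (set_det V f + set_det (V - {v}) f) + set_det (S - {r}) f * set_det V f"
proof -
  let ?g = "\<lambda>x y. f x y + edge_laplacian r v x y"
  define h where "h = ?g(r := f r)"
  have ne: "r \<noteq> v" using disj rv by auto
  have "?g = h(r := \<lambda>y. h r y + ((if y = r then 1 else 0) - (if y = v then 1 else 0)))"
    using ne by (auto simp: h_def edge_laplacian_def fun_eq_iff)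
  then have "set_det (S \<union> V) ?g = set_det (S \<union> V) h + set_det (S \<union> V - {r}) (merge_column r v h)"
    using set_det_row_add_difference[of "S \<union> V" r v h] fin rv ne by simp
  moreover have "set_det (S \<union> V) h = set_det S h * set_det V h"
    using fin disj rv zero by (intro set_det_block) (auto simp: h_def edge_laplacian_def)
  moreover have "set_det S h = set_det S f"
    using disj rv by (intro set_det_cong) (auto simp: h_def edge_laplacian_def)
  moreover have "set_det V h = set_det V (f(v := \<lambda>y. f v y + (if y = v then 1 else 0)))"
    using disj rv by (intro set_det_cong) (auto simp: h_def edge_laplacian_def)
  moreover have "\<dots> = set_det V f + set_det (V - {v}) f"
    using set_det_diag_add[OF fin(2) rv(2), of f 1] by simp
  moreover have "set_det (S \<union> V - {r}) (merge_column r v h)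
      = set_det (S - {r}) (merge_column r v h) * set_det V (merge_column r v h)"
  proof -
    have "S \<union> V - {r} = V \<union> (S - {r})" using disj rv by auto
    moreover have "set_det (V \<union> (S - {r})) (merge_column r v h)
        = set_det V (merge_column r v h) * set_det (S - {r}) (merge_column r v h)"
    proof (rule set_det_block)
      fix x y assume xy: "x \<in> V" "y \<in> S - {r}"
      then have "f x y = 0" "x \<noteq> y" "y \<noteq> v" "x \<noteq> r" "y \<noteq> r" using zero[of y x] disj rv by auto
      then show "merge_column r v h x y = 0"
        by (simp add: h_def merge_column_def edge_laplacian_def)
    qed (use fin disj in auto)
    ultimately show ?thesis by (simp add: mult.commute)
  qed
  moreover have "set_det (S - {r}) (merge_column r v h) = set_det (S - {r}) f"
    using disj rv by (intro set_det_cong) (auto simp: h_def merge_column_def edge_laplacian_def)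
  moreover have "set_det V (merge_column r v h) = set_det V f"
  proof (rule set_det_cong)
    fix x y assume xy: "x \<in> V" "y \<in> V"
    then have "f x r = 0" "x \<noteq> r" "y \<noteq> r" using zero[of r x] disj rv by auto
    then show "merge_column r v h x y = f x y"
      using ne by (simp add: h_def merge_column_def edge_laplacian_def)
  qed
  ultimately show ?thesis by simp
qed

section \<open>Laplacian coefficients as coefficients of a determinant\<close>

definition lap_entry :: "'a rel \<Rightarrow> 'a \<Rightarrow> 'a \<Rightarrow> real poly" where
  "lap_entry E x y = (if x = y then of_nat (card (E `` {x})) else 0) - (if (x, y) \<in> E then 1 else 0)"

definition char_entry :: "'a rel \<Rightarrow> 'a \<Rightarrow> 'a \<Rightarrow> real poly" where
  "char_entry E x y = (if x = y then X else 0) + lap_entry E x y"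

lemma out_degree_eq: "out_degree (with_proj G) v = card (parcs G `` {v})"
proof -
  have "out_arcs (with_proj G) v = Pair v ` (parcs G `` {v})"
    by (auto simp: out_arcs_def with_proj_def)
  then show ?thesis by (simp add: out_degree_def card_image inj_on_def)
qed

text \<open>The determinant of \<open>xI + L\<close> is \<open>(-1)^n\<close> times the
  characteristic polynomial at \<open>-x\<close>; the substitution is the composition with
  \<open>[:0, -1:]\<close>.\<close>

lemma coeff_set_det_char_entry:
  assumes fin: "finite (pverts G)"
  shows "coeff (set_det (pverts G) (char_entry (parcs G))) i
    = (-1) ^ (graph_order G + i) * coeff (laplacian_poly G) i"
proof -
  let ?V = "pverts G" and ?E = "parcs G"
  obtain vs where vs: "distinct vs" "set vs = ?V" using finite_distinct_list fin by blast
  let ?n = "length vs"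
  have n: "graph_order G = ?n" using vs distinct_card by (fastforce simp: graph_order_def)
  let ?f = "\<lambda>x y. (if x = y then X else 0) - lap_entry ?E x y"
  have "char_poly_matrix (laplacian_mat G vs) = mat ?n ?n (\<lambda>(i, j). ?f (vs ! i) (vs ! j))"
    using vs by (intro eq_matI) (auto simp: char_poly_matrix_def laplacian_mat_def degree_mat_def
        adjacency_mat_def lap_entry_def X_def out_degree_eq nth_eq_iff_index_eq one_pCons of_nat_poly)
  then have lap: "laplacian_poly G = set_det ?V ?f"
    by (simp add: laplacian_poly_eq[OF vs] char_poly_def set_det_list[OF vs])
  have neg: "pcompose (?f x y) [:0, -1:] = - char_entry ?E x y" for x y
    by (simp add: char_entry_def lap_entry_def X_def pcompose_diff pcompose_pCons of_nat_poly one_pCons)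
  have "pcompose (laplacian_poly G) [:0, -1:]
      = (\<Sum>p | p permutes ?V. of_int (sign p) * (\<Prod>i\<in>?V. - char_entry ?E i (p i)))"
    unfolding lap set_det_def pcompose_sum pcompose_mult pcompose_prod neg
    by (intro sum.cong refl) (auto simp: sign_def pcompose_1 pcompose_uminus)
  also have "\<dots> = (-1) ^ ?n * set_det ?V (char_entry ?E)"
    using n by (simp add: set_det_def prod_uminus graph_order_def sum_distrib_left mult_ac)
  finally have "(-1) ^ ?n * set_det ?V (char_entry ?E) = pcompose (laplacian_poly G) [:0, -1:]" ..
  then have "(-1) ^ ?n * ((-1) ^ ?n * set_det ?V (char_entry ?E))
      = (-1) ^ ?n * pcompose (laplacian_poly G) [:0, -1:]" by simp
  moreover have "(-1) ^ ?n * ((-1) ^ ?n * q) = q" for q :: "real poly"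
    by (simp add: mult.assoc[symmetric] power_mult_distrib[symmetric])
  moreover have "(-1) ^ k * q = Polynomial.smult ((-1) ^ k) q" for k and q :: "real poly"
    by (cases "even k") auto
  ultimately have "set_det ?V (char_entry ?E) = Polynomial.smult ((-1) ^ ?n) (pcompose (laplacian_poly G) [:0, -1:])"
    by simp
  then show ?thesis
    using n by (simp add: coeff_pcompose_linear power_add)
qed

section \<open>Rooted trees as subgraphs\<close>

inductive realizes :: "'a set \<Rightarrow> 'a rel \<Rightarrow> 'a \<Rightarrow> rooted_tree \<Rightarrow> bool" where
  single: "realizes {r} {} r Root"
| branch: "realizes V\<^sub>1 E\<^sub>1 v t \<Longrightarrow> realizes V\<^sub>2 E\<^sub>2 r s \<Longrightarrow> V\<^sub>1 \<inter> V\<^sub>2 = {} \<Longrightarrow>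
    realizes (V\<^sub>1 \<union> V\<^sub>2) (E\<^sub>1 \<union> E\<^sub>2 \<union> {(r, v), (v, r)}) r (Branch t s)"

lemma realizes_basic:
  "realizes V E r t \<Longrightarrow> finite V \<and> r \<in> V \<and> E \<subseteq> V \<times> V \<and> (\<forall>x. (x, x) \<notin> E) \<and> card V = Suc (num_edges t)"
  by (induction rule: realizes.induct) (auto simp: card_Un_disjoint)

lemma realizes_root_isolated: "realizes V E r t \<Longrightarrow> E `` {r} = {} \<longleftrightarrow> t = Root"
  by (induction rule: realizes.induct) auto

text \<open>Hanging \<open>t\<close> on \<open>r\<close> adds one to the degree of \<open>v\<close>,
  which thereby is a leaf exactly if it was isolated in \<open>t\<close>; all other vertices except
  \<open>r\<close> keep their degree.\<close>

lemma realizes_leaves: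
  "realizes V E r t \<Longrightarrow> card {v \<in> V - {r}. card (E `` {v}) = 1} = num_leaves t"
proof (induction rule: realizes.induct)
  case (single r)
  then show ?case by simp
next
  case (branch V\<^sub>1 E\<^sub>1 v t V\<^sub>2 E\<^sub>2 r s)
  note B\<^sub>1 = realizes_basic[OF branch.hyps(1)] and B\<^sub>2 = realizes_basic[OF branch.hyps(2)]
  let ?E = "E\<^sub>1 \<union> E\<^sub>2 \<union> {(r, v), (v, r)}"
  let ?L = "{x \<in> V\<^sub>1 \<union> V\<^sub>2 - {r}. card (?E `` {x}) = 1}"
  let ?L1 = "{x \<in> V\<^sub>1 - {v}. card (E\<^sub>1 `` {x}) = 1}" and ?L2 = "{x \<in> V\<^sub>2 - {r}. card (E\<^sub>2 `` {x}) = 1}"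
  have fin: "finite V\<^sub>1" "finite V\<^sub>2" using B\<^sub>1 B\<^sub>2 by auto
  have a: "?E `` {x} = E\<^sub>1 `` {x}" if "x \<in> V\<^sub>1 - {v}" for x
    using that B\<^sub>1 B\<^sub>2 branch.hyps(3) by auto
  have b: "?E `` {x} = E\<^sub>2 `` {x}" if "x \<in> V\<^sub>2 - {r}" for x
    using that B\<^sub>1 B\<^sub>2 branch.hyps(3) by auto
  have c: "?E `` {v} = insert r (E\<^sub>1 `` {v})"
    using B\<^sub>1 B\<^sub>2 branch.hyps(3) by auto
  have "finite (E\<^sub>1 `` {v})" "r \<notin> E\<^sub>1 `` {v}"
    using B\<^sub>1 B\<^sub>2 branch.hyps(3) fin by (auto intro: finite_subset[of _ V\<^sub>1])
  then have d: "card (?E `` {v}) = 1 \<longleftrightarrow> t = Root"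
    unfolding c using realizes_root_isolated[OF branch.hyps(1)] by auto
  have "?L = (if t = Root then {v} else {}) \<union> ?L1 \<union> ?L2"
  proof (rule Set.set_eqI)
    fix x
    consider "x = v" | "x \<in> V\<^sub>1 - {v}" | "x \<in> V\<^sub>2 - {r}" | "x \<notin> V\<^sub>1 \<union> V\<^sub>2 - {r}"
      using B\<^sub>1 B\<^sub>2 by blast
    then show "x \<in> ?L \<longleftrightarrow> x \<in> (if t = Root then {v} else {}) \<union> ?L1 \<union> ?L2"
    proof cases
      case 1
      then show ?thesis using d B\<^sub>1 B\<^sub>2 branch.hyps(3) by auto
    next
      case 2
      then show ?thesis using a[OF 2] B\<^sub>2 branch.hyps(3) by auto
    next
      case 3
      then show ?thesis using b[OF 3] B\<^sub>1 branch.hyps(3) by auto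
    next
      case 4
      then show ?thesis using B\<^sub>1 B\<^sub>2 branch.hyps(3) by auto
    qed
  qed
  also have "card \<dots> = card ((if t = Root then {v} else {}) \<union> ?L1) + card ?L2"
  proof (rule card_Un_disjoint)
    have "(if t = Root then {v} else {}) \<subseteq> V\<^sub>1" "?L1 \<subseteq> V\<^sub>1" "?L2 \<subseteq> V\<^sub>2"
      using B\<^sub>1 by auto
    then show "((if t = Root then {v} else {}) \<union> ?L1) \<inter> ?L2 = {}"
      using branch.hyps(3) by (meson disjoint_iff subsetD UnE)
  qed (use fin in simp_all)
  also have "card ((if t = Root then {v} else {}) \<union> ?L1) = (if t = Root then 1 else 0) + card ?L1"
    using fin by (subst card_Un_disjoint) simp_all
  finally show ?case unfolding branch.IH by simp
qed

lemma realizes_glue: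
  "realizes V\<^sub>1 E\<^sub>1 r t \<Longrightarrow> realizes V\<^sub>2 E\<^sub>2 r s \<Longrightarrow> V\<^sub>1 \<inter> V\<^sub>2 = {r} \<Longrightarrow>
    realizes (V\<^sub>1 \<union> V\<^sub>2) (E\<^sub>1 \<union> E\<^sub>2) r (glue t s)"
proof (induction rule: realizes.induct)
  case (single r)
  then have "{r} \<union> V\<^sub>2 = V\<^sub>2" by auto
  then show ?case using single by simp
next
  case (branch Va Ea v t Vb Eb r t')
  note a = realizes_basic[OF branch.hyps(1)] and b = realizes_basic[OF branch.hyps(2)]
    and c = realizes_basic[OF branch.prems(1)]
  have r: "r \<notin> Va" using b branch.hyps(3) by auto
  have "realizes (Vb \<union> V\<^sub>2) (Eb \<union> E\<^sub>2) r (glue t' s)"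
    using branch.IH(2) branch.prems b by blast
  moreover have "Va \<inter> (Vb \<union> V\<^sub>2) = {}" using branch.hyps(3) branch.prems(2) r by auto
  ultimately have "realizes (Va \<union> (Vb \<union> V\<^sub>2)) (Ea \<union> (Eb \<union> E\<^sub>2) \<union> {(r, v), (v, r)}) r (Branch t (glue t' s))"
    by (rule realizes.branch[OF branch.hyps(1)])
  then show ?case by (simp add: Un_ac insert_commute)
qed

section \<open>Determinant of a graph with a tree attached\<close>

lemma lap_entry_Un:
  assumes "finite E\<^sub>1" "finite E\<^sub>2" "E\<^sub>1 \<inter> E\<^sub>2 = {}"
  shows "lap_entry (E\<^sub>1 \<union> E\<^sub>2) x y = lap_entry E\<^sub>1 x y + lap_entry E\<^sub>2 x y"
proof -
  have "card ((E\<^sub>1 \<union> E\<^sub>2) `` {x}) = card (E\<^sub>1 `` {x}) + card (E\<^sub>2 `` {x})"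
    unfolding Un_Image by (intro card_Un_disjoint) (use assms in auto)
  then show ?thesis using assms(3) by (auto simp: lap_entry_def)
qed

lemma lap_entry_edge:
  assumes "r \<noteq> v"
  shows "lap_entry {(r, v), (v, r)} x y = edge_laplacian r v x y"
proof -
  have "{(r, v), (v, r)} `` {x} = (if x = r then {v} else if x = v then {r} else {})"
    using assms by auto
  then have "card ({(r, v), (v, r)} `` {x}) = (if x = r \<or> x = v then 1 else 0)"
    by (simp only: card_1_singleton_iff card.empty split: if_split) auto
  then show ?thesis
    unfolding lap_entry_def edge_laplacian_def by (simp only:) (use assms in auto)
qed

lemma lap_entry_outside: "E \<subseteq> V \<times> V \<Longrightarrow> x \<notin> V \<or> y \<notin> V \<Longrightarrow> lap_entry E x y = 0"
proof -
  assume "E \<subseteq> V \<times> V" "x \<notin> V \<or> y \<notin> V"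
  moreover from this have "E `` {x} = {}" if "x = y" using that by auto
  ultimately show ?thesis by (auto simp: lap_entry_def)
qed

abbreviation supported_on :: "'a set \<Rightarrow> ('a \<Rightarrow> 'a \<Rightarrow> 'r :: zero) \<Rightarrow> bool" where
  "supported_on S M \<equiv> \<forall>x y. x \<notin> S \<or> y \<notin> S \<longrightarrow> M x y = 0"

text \<open>Raising the diagonal entry of \<open>M\<close> at \<open>r\<close> by 1 adds the minor
  at \<open>r\<close> on both sides of the attachment formula; comparing the formula for the two
  matrices gives the minor.\<close>

lemma set_det_minus_root:
  assumes "finite T" "S \<subseteq> T" "r \<in> S"
    and attach: "\<And>M. supported_on S M \<Longrightarrow>
      set_det T (\<lambda>x y. M x y + N x y) = set_det S M * a + set_det (S - {r}) M * b"
    and M: "supported_on S M"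
  shows "set_det (T - {r}) (\<lambda>x y. M x y + N x y) = set_det (S - {r}) M * a"
proof -
  have fin: "finite S" using assms finite_subset by blast
  let ?M = "M(r := \<lambda>y. M r y + (if y = r then 1 else 0))"
  have supp: "supported_on S ?M" using M assms(3) by auto
  have M1: "set_det (S - {r}) ?M = set_det (S - {r}) M" by (rule set_det_cong) auto
  have M2: "set_det S ?M = set_det S M + set_det (S - {r}) M"
    using set_det_diag_add[OF fin assms(3), of M 1] by simp
  have 1: "set_det T (\<lambda>x y. ?M x y + N x y)
      = (set_det S M + set_det (S - {r}) M) * a + set_det (S - {r}) M * b"
    unfolding attach[OF supp] M1 M2 ..
  have r: "r \<in> T" using assms(2,3) by auto
  have upd: "(\<lambda>x y. ?M x y + N x y)
      = (\<lambda>x y. M x y + N x y)(r := \<lambda>y. M r y + N r y + (if y = r then 1 else 0))"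
    by (auto simp: fun_eq_iff)
  have 2: "set_det T (\<lambda>x y. ?M x y + N x y)
      = set_det T (\<lambda>x y. M x y + N x y) + set_det (T - {r}) (\<lambda>x y. M x y + N x y)"
    unfolding upd using set_det_diag_add[OF assms(1) r, of "\<lambda>x y. M x y + N x y" 1] by simp
  show ?thesis using 1 unfolding 2 attach[OF M] by (simp add: algebra_simps)
qed

definition tree_entry :: "'a set \<Rightarrow> 'a rel \<Rightarrow> 'a \<Rightarrow> 'a \<Rightarrow> 'a \<Rightarrow> real poly" where
  "tree_entry V E r x y = (if x = y \<and> x \<in> V - {r} then X else 0) + lap_entry E x y"

text \<open>
  The entries at the root carry no \<open>x\<close>: that of the vertex \<open>r\<close> belongs to the matrix \<open>M\<close> to which
  the tree is attached.
\<close>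

lemma set_det_attach:
  assumes "realizes V E r t" "finite S" "S \<inter> V = {r}" "supported_on S M"
  shows "set_det (S \<union> V) (\<lambda>x y. M x y + tree_entry V E r x y)
    = set_det S M * root_poly t + set_det (S - {r}) M * nonroot_poly t"
  using assms
proof (induction arbitrary: S M rule: realizes.induct)
  case (single r)
  then have "S \<union> {r} = S" by auto
  moreover have "tree_entry {r} {} r x y = 0" for x y
    by (simp add: tree_entry_def lap_entry_def Image_def)
  ultimately show ?case by simp
next
  case (branch V\<^sub>1 E\<^sub>1 v t V\<^sub>2 E\<^sub>2 r s)
  note 1 = realizes_basic[OF branch.hyps(1)] and 2 = realizes_basic[OF branch.hyps(2)]
  let ?S = "S \<union> V\<^sub>2"
  have r2: "r \<in> V\<^sub>2" and v1: "v \<in> V\<^sub>1" using 1 2 by auto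
  have rS: "r \<in> S" using branch.prems(2) by auto
  have r1: "r \<notin> V\<^sub>1" and v2: "v \<notin> V\<^sub>2" using branch.hyps(3) r2 v1 by auto
  have disj1: "S \<inter> V\<^sub>1 = {}" using branch.prems(2) r1 by auto
  have SV2: "S \<inter> V\<^sub>2 = {r}" using branch.prems(2) r2 by auto
  have disj: "?S \<inter> V\<^sub>1 = {}" using disj1 branch.hyps(3) by auto
  have vS: "v \<notin> S" using disj1 v1 by auto
  have V1: "{v} \<union> V\<^sub>1 = V\<^sub>1" using v1 by auto
  note r = rS r2 r1 and v = v1 vS v2
  have ne: "r \<noteq> v" using r v by auto
  have fin: "finite E\<^sub>1" "finite E\<^sub>2" "finite V\<^sub>1" "finite V\<^sub>2"
    using 1 2 finite_subset[of E\<^sub>1 "V\<^sub>1 \<times> V\<^sub>1"] finite_subset[of E\<^sub>2 "V\<^sub>2 \<times> V\<^sub>2"] by auto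
  define N where "N = (\<lambda>x y. (if x = y \<and> x \<in> V\<^sub>1 then X else 0) + lap_entry E\<^sub>1 x y)"
  define f where "f = (\<lambda>x y. M x y + tree_entry V\<^sub>2 E\<^sub>2 r x y + N x y)"
  have lap: "lap_entry (E\<^sub>1 \<union> E\<^sub>2 \<union> {(r, v), (v, r)}) x y
      = lap_entry E\<^sub>1 x y + lap_entry E\<^sub>2 x y + edge_laplacian r v x y" for x y
  proof -
    have e: "(E\<^sub>1 \<union> E\<^sub>2) \<inter> {(r, v), (v, r)} = {}" "E\<^sub>1 \<inter> E\<^sub>2 = {}"
      using 1 2 branch.hyps(3) r v by auto
    have "lap_entry (E\<^sub>1 \<union> E\<^sub>2 \<union> {(r, v), (v, r)}) x y
        = lap_entry (E\<^sub>1 \<union> E\<^sub>2) x y + lap_entry {(r, v), (v, r)} x y"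
      by (rule lap_entry_Un) (use fin e(1) in simp_all)
    also have "lap_entry (E\<^sub>1 \<union> E\<^sub>2) x y = lap_entry E\<^sub>1 x y + lap_entry E\<^sub>2 x y"
      by (rule lap_entry_Un) (use fin e(2) in simp_all)
    finally show ?thesis by (simp only: lap_entry_edge[OF ne])
  qed
  have N0: "N x y = 0" if "x \<in> ?S \<or> y \<in> ?S" for x y
    using that disj 1 lap_entry_outside[of E\<^sub>1 V\<^sub>1 x y] by (auto simp: N_def)
  have M0: "M x y = 0" if "x \<in> V\<^sub>1 \<or> y \<in> V\<^sub>1" for x y
  proof -
    have "x \<notin> S \<or> y \<notin> S" using that disj1 by auto
    then show ?thesis using branch.prems(3) by simp
  qed
  have T0: "tree_entry V\<^sub>2 E\<^sub>2 r x y = 0" if "x \<in> V\<^sub>1 \<or> y \<in> V\<^sub>1" for x y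
  proof -
    have "x \<notin> V\<^sub>2 \<or> y \<notin> V\<^sub>2" using that branch.hyps(3) by auto
    then show ?thesis using lap_entry_outside[of E\<^sub>2 V\<^sub>2 x y] 2 by (auto simp: tree_entry_def)
  qed
  have "set_det (S \<union> (V\<^sub>1 \<union> V\<^sub>2)) (\<lambda>x y. M x y
        + tree_entry (V\<^sub>1 \<union> V\<^sub>2) (E\<^sub>1 \<union> E\<^sub>2 \<union> {(r, v), (v, r)}) r x y)
      = set_det (?S \<union> V\<^sub>1) (\<lambda>x y. f x y + edge_laplacian r v x y)"
  proof -
    have "S \<union> (V\<^sub>1 \<union> V\<^sub>2) = ?S \<union> V\<^sub>1" by auto
    moreover have "M x y + tree_entry (V\<^sub>1 \<union> V\<^sub>2) (E\<^sub>1 \<union> E\<^sub>2 \<union> {(r, v), (v, r)}) r x y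
        = f x y + edge_laplacian r v x y" for x y
    proof -
      have "(if x = y \<and> x \<in> V\<^sub>1 \<union> V\<^sub>2 - {r} then X else 0)
          = (if x = y \<and> x \<in> V\<^sub>2 - {r} then X else 0) + (if x = y \<and> x \<in> V\<^sub>1 then X else 0)"
        using r1 branch.hyps(3) by auto
      then show ?thesis
        unfolding tree_entry_def f_def N_def lap by (simp only: algebra_simps)
    qed
    ultimately show ?thesis by simp
  qed
  \<comment> \<open>The edge between \<open>r\<close> and \<open>v\<close> is a bridge from
    \<open>S\<close> with \<open>s\<close> attached to \<open>t\<close>. The factor
    \<open>A + B\<close> of \<open>t\<close> is the \<open>(X + 1) B + C\<close> in the recursion
    for \<open>Branch\<close>.\<close>
  also have "\<dots> = set_det ?S f * (set_det V\<^sub>1 f + set_det (V\<^sub>1 - {v}) f) + set_det (?S - {r}) f * set_det V\<^sub>1 f"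
  proof (rule set_det_bridge)
    fix x y assume "x \<in> ?S" "y \<in> V\<^sub>1"
    then show "f x y = 0 \<and> f y x = 0"
      using N0[of x y] N0[of y x] T0[of x y] T0[of y x] M0[of x y] M0[of y x] by (simp add: f_def)
  qed (use fin branch.prems(1) disj rS v1 in auto)
  also have "set_det ?S f = set_det ?S (\<lambda>x y. M x y + tree_entry V\<^sub>2 E\<^sub>2 r x y)"
    by (rule set_det_cong) (use N0 in \<open>simp add: f_def\<close>)
  also have "\<dots> = set_det S M * root_poly s + set_det (S - {r}) M * nonroot_poly s"
    by (rule branch.IH(2)[OF branch.prems(1) SV2 branch.prems(3)])
  also have "set_det (?S - {r}) f = set_det (?S - {r}) (\<lambda>x y. M x y + tree_entry V\<^sub>2 E\<^sub>2 r x y)"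
    by (rule set_det_cong) (use N0 in \<open>simp add: f_def\<close>)
  also have "\<dots> = set_det (S - {r}) M * root_poly s"
    using fin branch.prems(1,3) r
    by (intro set_det_minus_root[OF _ _ _ branch.IH(2)[OF branch.prems(1) SV2]]) auto
  also have "set_det V\<^sub>1 f = X * root_poly t + nonroot_poly t"
  proof -
    \<comment> \<open>A single vertex carrying the \<open>X\<close> that \<open>tree_entry\<close>
      omits at its root.\<close>
    let ?D = "\<lambda>x y. if x = v \<and> y = v then X else 0"
    have "set_det V\<^sub>1 f = set_det V\<^sub>1 (\<lambda>x y. ?D x y + tree_entry V\<^sub>1 E\<^sub>1 v x y)"
    proof (rule set_det_cong)
      fix x y assume xy: "x \<in> V\<^sub>1" "y \<in> V\<^sub>1"
      have "f x y = N x y" using T0[of x y] M0[of x y] xy by (simp add: f_def)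
      also have "\<dots> = ?D x y + tree_entry V\<^sub>1 E\<^sub>1 v x y"
        unfolding N_def tree_entry_def using xy by (cases "x = y"; cases "x = v") simp_all
      finally show "f x y = ?D x y + tree_entry V\<^sub>1 E\<^sub>1 v x y" .
    qed
    also have "\<dots> = set_det {v} ?D * root_poly t + set_det ({v} - {v}) ?D * nonroot_poly t"
      using branch.IH(1)[of "{v}" ?D] v1 unfolding V1 by auto
    finally show ?thesis by (simp add: set_det_def)
  qed
  also have "set_det (V\<^sub>1 - {v}) f = root_poly t"
  proof -
    let ?D = "\<lambda>x y. 0 :: real poly"
    have "set_det (V\<^sub>1 - {v}) f = set_det (V\<^sub>1 - {v}) (\<lambda>x y. ?D x y + tree_entry V\<^sub>1 E\<^sub>1 v x y)"
    proof (rule set_det_cong)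
      fix x y assume xy: "x \<in> V\<^sub>1 - {v}" "y \<in> V\<^sub>1 - {v}"
      have "f x y = N x y" using T0[of x y] M0[of x y] xy by (simp add: f_def)
      also have "\<dots> = ?D x y + tree_entry V\<^sub>1 E\<^sub>1 v x y"
        unfolding N_def tree_entry_def using xy by (cases "x = y"; cases "x = v") simp_all
      finally show "f x y = ?D x y + tree_entry V\<^sub>1 E\<^sub>1 v x y" .
    qed
    also have "set_det (V\<^sub>1 - {v}) (\<lambda>x y. ?D x y + tree_entry V\<^sub>1 E\<^sub>1 v x y)
        = set_det ({v} - {v}) ?D * root_poly t"
    proof (rule set_det_minus_root)
      fix M :: "'a \<Rightarrow> 'a \<Rightarrow> real poly" assume "supported_on {v} M"
      then show "set_det V\<^sub>1 (\<lambda>x y. M x y + tree_entry V\<^sub>1 E\<^sub>1 v x y)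
          = set_det {v} M * root_poly t + set_det ({v} - {v}) M * nonroot_poly t"
        using branch.IH(1)[of "{v}" M] v1 unfolding V1 by auto
    qed (use v1 fin in auto)
    finally show ?thesis by simp
  qed
  finally show ?case by (simp add: algebra_simps)
qed

section \<open>Recognizing trees\<close>

text \<open>On a walk of least length no vertex repeats, since the stretch between two visits could
  be cut out.\<close>

lemma relpow_avoiding_repetition:
  assumes "(a, b) \<in> R\<^sup>*"
  shows "\<exists>n f. f 0 = a \<and> f n = b \<and> (\<forall>i<n. (f i, f (Suc i)) \<in> R) \<and> inj_on f {..n}"
proof -
  define n where "n = (LEAST n. (a, b) \<in> R ^^ n)"
  have "\<exists>n. (a, b) \<in> R ^^ n" using assms by (auto simp: rtrancl_power)
  then have n: "(a, b) \<in> R ^^ n" unfolding n_def by (rule LeastI_ex)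
  have least: "n \<le> m" if "(a, b) \<in> R ^^ m" for m using that unfolding n_def by (rule Least_le)
  from n obtain f where f: "f 0 = a" "f n = b" "\<forall>i<n. (f i, f (Suc i)) \<in> R"
    by (auto simp: relpow_fun_conv)
  have seg: "(f i, f (i + k)) \<in> R ^^ k" if "i + k \<le> n" for i k
    unfolding relpow_fun_conv by (rule exI[of _ "\<lambda>m. f (i + m)"]) (use f(3) that in auto)
  have ne: "f i \<noteq> f j" if ij: "i < j" "j \<le> n" for i j
  proof
    assume eq: "f i = f j"
    have "(a, f i) \<in> R ^^ i" using seg[of 0 i] f(1) ij by simp
    moreover have "(f i, b) \<in> R ^^ (n - j)" using seg[of j "n - j"] f(2) ij eq by simp
    ultimately have "(a, b) \<in> R ^^ (i + (n - j))" unfolding relpow_add by blast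
    then show False using least[of "i + (n - j)"] ij by simp
  qed
  have "inj_on f {..n}"
  proof (rule inj_onI)
    fix i j assume "i \<in> {..n}" "j \<in> {..n}" "f i = f j"
    then show "i = j" using ne[of i j] ne[of j i] by (cases i j rule: linorder_cases) auto
  qed
  with f show ?thesis by blast
qed

lemma rtrancl_sym: "sym R \<Longrightarrow> (a, b) \<in> R\<^sup>* \<Longrightarrow> (b, a) \<in> R\<^sup>*"
  by (meson sym_rtrancl symD)

text \<open>Removing an edge at \<open>r\<close> splits the graph into the parts reachable from its
  two ends; a path still joining the ends would close to a cycle. Both parts inherit the hypotheses
  and are smaller.\<close>

lemma realizes_if_tree:
  assumes "finite V" "E \<subseteq> V \<times> V" "sym E" "\<And>x. (x, x) \<notin> E" "r \<in> V"
    and "\<And>x. x \<in> V \<Longrightarrow> (r, x) \<in> E\<^sup>*"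
    and "\<And>k w. 3 \<le> k \<Longrightarrow> inj_on w {1..k} \<Longrightarrow> \<forall>i\<in>{1..<k}. (w i, w (Suc i)) \<in> E \<Longrightarrow> (w k, w 1) \<notin> E"
  shows "\<exists>t. realizes V E r t"
  using assms
proof (induction "card V" arbitrary: V E r rule: less_induct)
  case less
  show ?case
  proof (cases "V = {r}")
    case True
    then have "E = {}" using less.prems(2,4) by auto
    then show ?thesis using True realizes.single[of r] by auto
  next
    case False
    then obtain x where "x \<in> V" "x \<noteq> r" using less.prems(5) by auto
    then obtain v where v: "(r, v) \<in> E"
      using less.prems(6)[of x] by (metis converse_rtranclE)
    have ne: "r \<noteq> v" using v less.prems(4) by auto
    have vr: "(v, r) \<in> E" using v less.prems(3) by (auto dest: symD)
    define E' where "E' = E - {(r, v), (v, r)}"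
    have symE': "sym E'" using less.prems(3) unfolding E'_def sym_def by auto
    define A where "A = {x. (v, x) \<in> E'\<^sup>*}"
    define B where "B = {x. (r, x) \<in> E'\<^sup>*}"
    have "(v, r) \<notin> E'\<^sup>*"
    proof
      assume "(v, r) \<in> E'\<^sup>*"
      then obtain n f where f: "f 0 = v" "f n = r" "\<forall>i<n. (f i, f (Suc i)) \<in> E'" "inj_on f {..n}"
        using relpow_avoiding_repetition by metis
      \<comment> \<open>Length 0 would identify the ends, and length 1 would use the removed edge;
        so the closed walk has at least three vertices.\<close>
      have "n \<noteq> 0" using f ne by (intro notI) auto
      moreover have "n \<noteq> 1" using f by (intro notI) (auto simp: E'_def)
      ultimately have n: "3 \<le> Suc n" by simp
      have "inj_on (\<lambda>i. f (i - 1)) {1..Suc n}"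
      proof (rule inj_onI)
        fix i j assume "i \<in> {1..Suc n}" "j \<in> {1..Suc n}" "f (i - 1) = f (j - 1)"
        then have "i - 1 = j - 1" using inj_onD[OF f(4), of "i - 1" "j - 1"] by auto
        then show "i = j" using \<open>i \<in> _\<close> \<open>j \<in> _\<close> by auto
      qed
      moreover have "\<forall>i\<in>{1..<Suc n}. (f (i - 1), f (Suc i - 1)) \<in> E"
      proof
        fix i assume "i \<in> {1..<Suc n}"
        then obtain j where "i = Suc j" "j < n" by (cases i) auto
        then show "(f (i - 1), f (Suc i - 1)) \<in> E" using f(3) by (auto simp: E'_def)
      qed
      ultimately have "(f (Suc n - 1), f (1 - 1)) \<notin> E"
        by (rule less.prems(7)[OF n])
      then show False using f(1,2) v by simp
    qed
    then have disj: "A \<inter> B = {}"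
      unfolding A_def B_def using rtrancl_sym[OF symE'] by (auto dest: rtrancl_trans)
    have AB: "r \<in> B" "v \<in> A" by (auto simp: A_def B_def)
    have E'V: "E' \<subseteq> V \<times> V" using less.prems(2) by (auto simp: E'_def)
    have inV: "r \<in> V" "v \<in> V" using v less.prems(2) by auto
    have reach_V: "x \<in> V" if "(y, x) \<in> E'\<^sup>*" "y \<in> V" for x y
      using that by (induction rule: rtrancl_induct) (use E'V in auto)
    have sub: "A \<subseteq> V" "B \<subseteq> V" using reach_V inV by (auto simp: A_def B_def)
    have "x \<in> A \<union> B" if "(r, x) \<in> E\<^sup>*" for x
      using that
    proof (induction rule: rtrancl_induct)
      case base
      then show ?case using AB by auto
    next
      case (step y z)
      show ?case
      proof (cases "(y, z) \<in> E'")
        case True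
        then show ?thesis using step.IH by (auto simp: A_def B_def intro: rtrancl.rtrancl_into_rtrancl)
      next
        case False
        then show ?thesis using step.hyps(2) AB by (auto simp: E'_def)
      qed
    qed
    then have V: "V = A \<union> B" using sub less.prems(6) by auto
    have closed: "b \<in> A \<longleftrightarrow> a \<in> A" "b \<in> B \<longleftrightarrow> a \<in> B" if "(a, b) \<in> E'" for a b
      using that symD[OF symE' that]
      by (auto simp: A_def B_def intro: rtrancl.rtrancl_into_rtrancl)
    let ?EA = "E' \<inter> A \<times> A" and ?EB = "E' \<inter> B \<times> B"
    have "E' = ?EA \<union> ?EB" using closed E'V unfolding V by blast
    then have E: "E = ?EA \<union> ?EB \<union> {(r, v), (v, r)}"
      using v vr unfolding E'_def by blast
    have connected: "(s, x) \<in> (E' \<inter> C \<times> C)\<^sup>*"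
      if "(s, x) \<in> E'\<^sup>*" "s \<in> C" "\<And>a b. (a, b) \<in> E' \<Longrightarrow> b \<in> C \<longleftrightarrow> a \<in> C" for s x C
    proof -
      have "(s, x) \<in> (E' \<inter> C \<times> C)\<^sup>* \<and> x \<in> C"
        using that(1)
      proof (induction rule: rtrancl_induct)
        case (step y z)
        then have "(y, z) \<in> E' \<inter> C \<times> C" using that(3) by auto
        then show ?case using step.IH by (auto intro: rtrancl.rtrancl_into_rtrancl)
      qed (use that(2) in auto)
      then show ?thesis ..
    qed
    have IH: "\<exists>t. realizes C (E' \<inter> C \<times> C) s t"
      if C: "C \<subset> V" "s \<in> C" "\<And>a b. (a, b) \<in> E' \<Longrightarrow> b \<in> C \<longleftrightarrow> a \<in> C" "\<And>x. x \<in> C \<Longrightarrow> (s, x) \<in> E'\<^sup>*"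
      for C s
    proof (rule less.hyps)
      show "card C < card V" using C(1) less.prems(1) by (rule psubset_card_mono[rotated])
      show "finite C" using C(1) less.prems(1) finite_subset by blast
      show "sym (E' \<inter> C \<times> C)" using symE' by (auto simp: sym_def)
      show "(x, x) \<notin> E' \<inter> C \<times> C" for x using less.prems(4) by (auto simp: E'_def)
      show "(s, x) \<in> (E' \<inter> C \<times> C)\<^sup>*" if "x \<in> C" for x
        using connected[OF C(4)[OF that] C(2,3)] by simp
      fix k w assume "3 \<le> (k :: nat)" "inj_on w {1..k}" "\<forall>i\<in>{1..<k}. (w i, w (Suc i)) \<in> E' \<inter> C \<times> C"
      then have "(w k, w 1) \<notin> E" by (intro less.prems(7)) (auto simp: E'_def)
      then show "(w k, w 1) \<notin> E' \<inter> C \<times> C" by (auto simp: E'_def)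
    qed (use C in auto)
    have "\<exists>t. realizes A ?EA v t"
    proof (rule IH)
      show "A \<subset> V" using sub AB disj inV by auto
    qed (use AB closed in blast, use closed in blast, simp add: A_def)
    moreover have "\<exists>t. realizes B ?EB r t"
    proof (rule IH)
      show "B \<subset> V" using sub AB disj inV by auto
    qed (use AB closed in blast, use closed in blast, simp add: B_def)
    ultimately obtain t s where "realizes A ?EA v t" "realizes B ?EB r s" by blast
    from realizes.branch[OF this disj] have "realizes V E r (Branch t s)"
      unfolding V[symmetric] E[symmetric] .
    then show ?thesis by blast
  qed
qed

lemma path_graph_arcs:
  "parcs (path_graph k p) = {(p i, p (Suc i)) | i. i \<in> {1..<k}} \<union> {(p i, p (Suc i)) | i. i \<in> {1..<k}}\<inverse>"
  "pverts (path_graph k p) = p ` {1..k}"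
  by (simp_all add: path_graph_def Let_def)

lemma cycle_graph_arcs:
  "parcs (cycle_graph g u) = insert (u g, u 1) {(u i, u (Suc i)) | i. i \<in> {1..<g}}
     \<union> (insert (u g, u 1) {(u i, u (Suc i)) | i. i \<in> {1..<g}})\<inverse>"
  "pverts (cycle_graph g u) = u ` {1..g}"
  by (simp_all add: cycle_graph_def Let_def)

lemma is_tree_realizes:
  assumes "is_tree T" "r \<in> pverts T"
  shows "\<exists>t. realizes (pverts T) (parcs T) r t"
proof -
  interpret pair_graph T using assms(1) by (simp add: is_tree_def)
  have sym: "sym (parcs T)"
    using pair_sym_arcs by (simp add: symmetric_def)
  have wf: "parcs T \<subseteq> pverts T \<times> pverts T"
    using in_arcsD1 in_arcsD2 by auto
  show ?thesis
  proof (rule realizes_if_tree[OF pair_finite_verts wf sym _ assms(2)])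
    show "(x, x) \<notin> parcs T" for x using pair_no_loops by fastforce
    show "(r, x) \<in> (parcs T)\<^sup>*" if "x \<in> pverts T" for x
    proof -
      have "connected (with_proj T)" using assms(1) by (simp add: is_tree_def)
      then have "(r, x) \<in> rtrancl_on (pverts (mk_symmetric (with_proj T))) (parcs (mk_symmetric (with_proj T)))"
        using assms(2) that
        by (simp add: connected_def strongly_connected_def reachable_def mk_symmetric_def)
      moreover have "parcs (mk_symmetric (with_proj T)) = parcs T"
        using sym by (auto simp: mk_symmetric_def dest: symD)
      ultimately show ?thesis using rtrancl_on_rtranclI by metis
    qed
    fix k :: nat and w
    assume k: "3 \<le> k" and inj: "inj_on w {1..k}" and steps: "\<forall>i\<in>{1..<k}. (w i, w (Suc i)) \<in> parcs T"
    show "(w k, w 1) \<notin> parcs T"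
    proof
      assume last: "(w k, w 1) \<in> parcs T"
      let ?C = "cycle_graph k w"
      have arcs: "parcs ?C \<subseteq> parcs T"
        using last steps sym unfolding cycle_graph_arcs by (auto dest: symD)
      have mem: "w i \<in> pverts T" if "i \<in> {1..k}" for i
        using that last steps in_arcsD1[of "w i"] by (cases "i = k") fastforce+
      then have verts: "pverts ?C \<subseteq> pverts T" by (auto simp: cycle_graph_arcs)
      have "wf_digraph (with_proj ?C)"
        by unfold_locales (use k in \<open>auto simp: cycle_graph_arcs\<close>)
      then have "subgraph (with_proj ?C) (with_proj T)"
        using arcs verts wf_digraph_axioms by (auto simp: subgraph_def compatible_def)
      then have "?C \<in> cycle_subgraphs T"
        using k inj by (auto simp: cycle_subgraphs_def)
      then show False using assms(1) by (auto simp: is_tree_def)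
    qed
  qed
qed

section \<open>Attaching trees to a graph\<close>

lemma char_entry_attach:
  assumes "realizes V E r t" "finite U" "C \<subseteq> U \<times> U" "\<And>x. (x, x) \<notin> C" "U \<inter> V = {r}"
    and "S \<subseteq> U" "r \<in> S" "x \<in> S \<union> V" "y \<in> S \<union> V"
  shows "char_entry (C \<union> E) x y
    = (if x \<in> S \<and> y \<in> S then char_entry C x y else 0) + tree_entry V E r x y"
proof -
  note V = realizes_basic[OF assms(1)]
  have "finite C" "finite E"
    using V finite_subset[OF assms(3)] finite_subset[of E "V \<times> V"] assms(2) by auto
  moreover have "C \<inter> E = {}"
  proof -
    have "a = r \<and> b = r" if "(a, b) \<in> C" "(a, b) \<in> E" for a b
      using that V assms(3,5) by blast
    then show ?thesis using assms(4) by fast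
  qed
  ultimately have lap: "lap_entry (C \<union> E) x y = lap_entry C x y + lap_entry E x y"
    by (rule lap_entry_Un)
  have S: "z \<in> U \<longleftrightarrow> z \<in> S" if "z \<in> S \<union> V" for z
    using that assms(5-7) by (metis IntI UnE singletonD subsetD)
  have out: "lap_entry C x y = 0" if "\<not> (x \<in> S \<and> y \<in> S)"
    using that S assms(3,8,9) by (intro lap_entry_outside[of C U]) auto
  have x: "x \<in> V - {r} \<longleftrightarrow> x \<notin> S"
    using assms(5-8) by (metis Diff_iff IntI UnE singletonD singletonI subsetD)
  show ?thesis
  proof (cases "x \<in> S \<and> y \<in> S")
    case True
    then show ?thesis using x by (auto simp: char_entry_def tree_entry_def lap)
  next
    case False
    then have "x = y \<Longrightarrow> x \<in> V - {r}" using x by blast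
    then show ?thesis
      unfolding char_entry_def tree_entry_def lap using out[OF False] False
      by (cases "x = y") simp_all
  qed
qed

text \<open>The index set \<open>S\<close> may be smaller than \<open>U\<close> while degrees are
  still counted in all of \<open>C\<close>, so principal minors are covered too.\<close>

lemma set_det_attach_graph:
  assumes "realizes V E r t" "finite U" "C \<subseteq> U \<times> U" "\<And>x. (x, x) \<notin> C" "U \<inter> V = {r}"
    and "S \<subseteq> U" "r \<in> S"
  shows "set_det (S \<union> V) (char_entry (C \<union> E))
    = set_det S (char_entry C) * root_poly t + set_det (S - {r}) (char_entry C) * nonroot_poly t"
proof -
  let ?M = "\<lambda>x y. if x \<in> S \<and> y \<in> S then char_entry C x y else 0"
  have fin: "finite S" and SV: "S \<inter> V = {r}" using assms finite_subset by auto
  have "set_det (S \<union> V) (char_entry (C \<union> E)) = set_det (S \<union> V) (\<lambda>x y. ?M x y + tree_entry V E r x y)"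
    by (rule set_det_cong) (rule char_entry_attach[OF assms])
  also have "\<dots> = set_det S ?M * root_poly t + set_det (S - {r}) ?M * nonroot_poly t"
    by (rule set_det_attach[OF assms(1) fin SV]) simp
  also have "set_det S ?M = set_det S (char_entry C)"
    by (rule set_det_cong) simp
  also have "set_det (S - {r}) ?M = set_det (S - {r}) (char_entry C)"
    by (rule set_det_cong) simp
  finally show ?thesis .
qed

lemma set_det_attach_two:
  assumes "realizes V E r t" "realizes V' E' r' t'" "finite U" "C \<subseteq> U \<times> U" "\<And>x. (x, x) \<notin> C"
    and "U \<inter> V = {r}" "U \<inter> V' = {r'}" "V \<inter> V' = {}"
  defines "D \<equiv> \<lambda>S. set_det S (char_entry C)"
  shows "set_det (U \<union> V \<union> V') (char_entry (C \<union> E \<union> E'))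
    = D U * (root_poly t * root_poly t')
      + (D (U - {r}) * nonroot_poly t * root_poly t' + D (U - {r'}) * root_poly t * nonroot_poly t')
      + D (U - {r'} - {r}) * nonroot_poly t * nonroot_poly t'"
proof -
  note V = realizes_basic[OF assms(1)] and V' = realizes_basic[OF assms(2)]
  have r: "r \<in> U" "r' \<in> U" "r' \<notin> V" "r \<noteq> r'" using assms(6-8) V V' by auto
  have "set_det (U \<union> V \<union> V') (char_entry (C \<union> E \<union> E'))
      = set_det (U \<union> V) (char_entry (C \<union> E)) * root_poly t'
        + set_det (U \<union> V - {r'}) (char_entry (C \<union> E)) * nonroot_poly t'"
  proof (rule set_det_attach_graph[OF assms(2)])
    show "finite (U \<union> V)" using assms(3) V by simp
    show "C \<union> E \<subseteq> (U \<union> V) \<times> (U \<union> V)" using assms(4) V by blast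
    show "(x, x) \<notin> C \<union> E" for x using assms(5) V by blast
    show "(U \<union> V) \<inter> V' = {r'}" using assms(7,8) by blast
  qed (use r in auto)
  also have "set_det (U \<union> V) (char_entry (C \<union> E)) = D U * root_poly t + D (U - {r}) * nonroot_poly t"
    unfolding D_def using r by (intro set_det_attach_graph[OF assms(1,3,4,5,6)]) auto
  also have "U \<union> V - {r'} = (U - {r'}) \<union> V" using r by auto
  also have "set_det ((U - {r'}) \<union> V) (char_entry (C \<union> E))
      = D (U - {r'}) * root_poly t + D (U - {r'} - {r}) * nonroot_poly t"
    unfolding D_def using r by (intro set_det_attach_graph[OF assms(1,3,4,5,6)]) auto
  finally show ?thesis by (simp add: algebra_simps)
qed

section \<open>Nonnegativity for graphs\<close>

lemma sum_char_entry:
  assumes "finite V" "E \<subseteq> V \<times> V" "x \<in> V"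
  shows "(\<Sum>y\<in>V. char_entry E x y) = X"
proof -
  have "V \<inter> {y. (x, y) \<in> E} = E `` {x}" using assms(2) by auto
  then have "(\<Sum>y\<in>V. if (x, y) \<in> E then 1 else 0) = (of_nat (card (E `` {x})) :: real poly)"
    using assms(1) by (simp add: sum.If_cases)
  then show ?thesis
    using assms(1,3) by (simp add: char_entry_def lap_entry_def sum.distrib sum_subtractf)
qed

lemma nonneg_offdiag: "x \<noteq> y \<Longrightarrow> nonneg_poly (- char_entry E x y)"
  by (simp add: char_entry_def lap_entry_def)

text \<open>Rows of \<open>xI + L\<close> sum to \<open>x\<close>, and restricting to
  \<open>S\<close> drops only nonpositive off-diagonal entries; at 1 every row sum is thus
  positive.\<close>

lemma set_det_char_entry_nonneg:
  assumes "finite V" "E \<subseteq> V \<times> V" "S \<subseteq> V"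
  shows "nonneg_poly (set_det S (char_entry E)) \<and> 0 < poly (set_det S (char_entry E)) 1"
proof -
  have fin: "finite S" using assms finite_subset by auto
  have row: "nonneg_poly (\<Sum>y\<in>S. char_entry E x y) \<and> 0 < poly (\<Sum>y\<in>S. char_entry E x y) 1"
    if x: "x \<in> S" for x
  proof -
    have "(\<Sum>y\<in>V. char_entry E x y) = (\<Sum>y\<in>V - S. char_entry E x y) + (\<Sum>y\<in>S. char_entry E x y)"
      by (rule sum.subset_diff[OF assms(3,1)])
    then have eq: "(\<Sum>y\<in>S. char_entry E x y) = X + (\<Sum>y\<in>V - S. - char_entry E x y)"
      using sum_char_entry[OF assms(1,2), of x] x assms(3) by (auto simp: sum_negf algebra_simps)
    have nn: "nonneg_poly (\<Sum>y\<in>V - S. - char_entry E x y)"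
      using x by (intro nonneg_poly_sum nonneg_offdiag) auto
    show ?thesis unfolding eq
      using nn nonneg_poly_poly[OF nn, of 1] by (auto intro!: nonneg_poly_add)
  qed
  have "nonneg_poly (set_det S (char_entry E))
      \<and> ((\<forall>x\<in>S. 0 < poly (\<Sum>y\<in>S. char_entry E x y) 1) \<longrightarrow> 0 < poly (set_det S (char_entry E)) 1)"
    using row nonneg_offdiag by (intro set_det_nonneg[OF fin]) auto
  then show ?thesis using row by blast
qed

text \<open>The difference is the determinant with the \<open>x\<close> at \<open>r\<close> removed;
  its row \<open>r\<close> has sum 0 and the other rows still have sum \<open>X\<close>.\<close>

lemma set_det_char_entry_root:
  assumes "finite V" "E \<subseteq> V \<times> V" "r \<in> V"
  shows "X * set_det (V - {r}) (char_entry E) \<le>\<^sub>p set_det V (char_entry E)"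
proof -
  let ?f = "(char_entry E)(r := \<lambda>y. char_entry E r y + (if y = r then - X else 0))"
  have "set_det V ?f = set_det V (char_entry E) - X * set_det (V - {r}) (char_entry E)"
    using set_det_diag_add[OF assms(1,3), of "char_entry E" "- X"] by simp
  moreover have "nonneg_poly (set_det V ?f)"
  proof (rule conjunct1[OF set_det_nonneg[OF assms(1)]])
    fix x assume x: "x \<in> V"
    show "nonneg_poly (\<Sum>y\<in>V. ?f x y)"
    proof (cases "x = r")
      case True
      then show ?thesis using sum_char_entry[OF assms(1,2) x] assms(1,3) by (simp add: sum.distrib)
    next
      case False
      then show ?thesis using sum_char_entry[OF assms(1,2) x] by simp
    qed
  next
    fix x y assume "x \<in> V" "y \<in> V" "x \<noteq> y"
    then show "nonneg_poly (- ?f x y)" using nonneg_offdiag[of x y E] by auto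
  qed
  ultimately show ?thesis by simp
qed

section \<open>Cycles\<close>

lemma cycle_graph_rotate_one:
  fixes u :: "nat \<Rightarrow> 'a"
  assumes "2 \<le> g"
  defines "w \<equiv> \<lambda>i. if i = g then u 1 else u (Suc i)"
  shows "cycle_graph g w = cycle_graph g u"
proof -
  have verts: "w ` {1..g} = u ` {1..g}"
  proof -
    have "w ` {1..<g} = (\<lambda>i. u (Suc i)) ` {1..<g}"
      by (rule image_cong) (auto simp: w_def)
    also have "\<dots> = u ` Suc ` {1..<g}" by (rule image_image[symmetric])
    also have "Suc ` {1..<g} = {2..g}"
      by (simp only: image_Suc_atLeastLessThan atLeastLessThanSuc_atLeastAtMost numeral_2_eq_2 One_nat_def)
    finally have "w ` {1..<g} = u ` {2..g}" .
    moreover have "{1..g} = insert g {1..<g}" "{1..g} = insert 1 {2..g}" using assms(1) by auto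
    moreover have "w g = u 1" by (simp add: w_def)
    ultimately show ?thesis by (metis image_insert)
  qed
  let ?E = "\<lambda>u. insert (u g, u 1) {(u i, u (Suc i)) | i. i \<in> {1..<g}}"
  have "?E w = ?E u"
  proof (rule Set.equalityI; rule subsetI)
    fix e assume "e \<in> ?E w"
    then consider "e = (w g, w 1)" | i where "i \<in> {1..<g}" "e = (w i, w (Suc i))" by blast
    then show "e \<in> ?E u"
    proof cases
      case 1
      then have "e = (u 1, u (Suc 1))" using assms(1) by (simp add: w_def)
      moreover have "1 \<in> {1..<g}" using assms(1) by simp
      ultimately show ?thesis by blast
    next
      case (2 i)
      show ?thesis
      proof (cases "Suc i = g")
        case True
        then show ?thesis using 2 by (simp add: w_def)
      next
        case False
        then have "e = (u (Suc i), u (Suc (Suc i)))" "Suc i \<in> {1..<g}" using 2 by (auto simp: w_def)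
        then show ?thesis by blast
      qed
    qed
  next
    fix e assume "e \<in> ?E u"
    then consider "e = (u g, u 1)" | i where "i \<in> {1..<g}" "e = (u i, u (Suc i))" by blast
    then show "e \<in> ?E w"
    proof cases
      case 1
      then have "e = (w (g - 1), w (Suc (g - 1)))" "g - 1 \<in> {1..<g}" using assms(1) by (auto simp: w_def)
      then show ?thesis by blast
    next
      case (2 i)
      show ?thesis
      proof (cases "i = 1")
        case True
        then show ?thesis using 2 by (simp add: w_def)
      next
        case False
        then have "e = (w (i - 1), w (Suc (i - 1)))" "i - 1 \<in> {1..<g}" using 2 by (auto simp: w_def)
        then show ?thesis by blast
      qed
    qed
  qed
  with verts show ?thesis unfolding cycle_graph_def Let_def by (simp only:)
qed

text \<open>By this symmetry any chosen cycle vertex can be given index 1, so all minors at one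
  vertex coincide.\<close>

lemma cycle_graph_rotate:
  assumes "2 \<le> g" "inj_on u {1..g}" "j \<in> {1..g}"
  shows "\<exists>w. inj_on w {1..g} \<and> w 1 = u j \<and> cycle_graph g w = cycle_graph g u"
  using assms(2,3)
proof (induction j arbitrary: u)
  case (Suc j)
  show ?case
  proof (cases "j = 0")
    case True
    then show ?thesis using Suc.prems by auto
  next
    case False
    define w where "w = (\<lambda>i. if i = g then u 1 else u (Suc i))"
    have "inj_on w {1..g}"
    proof (rule inj_onI)
      fix a b assume ab: "a \<in> {1..g}" "b \<in> {1..g}" "w a = w b"
      let ?s = "\<lambda>i. if i = g then 1 else Suc i"
      have "u (?s a) = u (?s b)" using ab(3) by (simp add: w_def split: if_splits)
      then have "?s a = ?s b" using ab(1,2) by (intro inj_onD[OF Suc.prems(1)]) auto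
      then show "a = b" using ab(1,2) by (cases "a = g"; cases "b = g") simp_all
    qed
    moreover have "j \<in> {1..g}" using False Suc.prems by simp
    ultimately obtain v where "inj_on v {1..g}" "v 1 = w j" "cycle_graph g v = cycle_graph g w"
      using Suc.IH by blast
    moreover have "w j = u (Suc j)" using Suc.prems by (simp add: w_def)
    moreover have "cycle_graph g w = cycle_graph g u"
      unfolding w_def by (rule cycle_graph_rotate_one[OF assms(1)])
    ultimately show ?thesis by metis
  qed
qed simp

lemma cycle_graph_wf:
  assumes "3 \<le> g" "inj_on u {1..g}"
  shows "parcs (cycle_graph g u) \<subseteq> pverts (cycle_graph g u) \<times> pverts (cycle_graph g u)"
    and "(x, x) \<notin> parcs (cycle_graph g u)"
proof -
  show "parcs (cycle_graph g u) \<subseteq> pverts (cycle_graph g u) \<times> pverts (cycle_graph g u)"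
    using assms(1) by (auto simp: cycle_graph_arcs)
  have "u g \<noteq> u 1" using assms(1) inj_onD[OF assms(2), of g 1] by auto
  moreover have "u (Suc i) \<noteq> u i" "u i \<noteq> u (Suc i)" if "i \<in> {1..<g}" for i
    using that inj_onD[OF assms(2), of i "Suc i"] by auto
  ultimately show "(x, x) \<notin> parcs (cycle_graph g u)"
    unfolding cycle_graph_arcs by auto
qed

lemma cycle_graph_degree:
  assumes "3 \<le> g" "inj_on u {1..g}" "v \<in> pverts (cycle_graph g u)"
  shows "2 \<le> card (parcs (cycle_graph g u) `` {v})"
proof -
  obtain j where "j \<in> {1..g}" "v = u j" using assms(3) by (auto simp: cycle_graph_arcs)
  then obtain w where w: "inj_on w {1..g}" "w 1 = v" "cycle_graph g w = cycle_graph g u"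
    using cycle_graph_rotate[OF _ assms(2), of j] assms(1) by auto
  let ?A = "parcs (cycle_graph g w) `` {v}"
  have "(w 1, w (Suc 1)) \<in> parcs (cycle_graph g w)"
    unfolding cycle_graph_arcs
    by (rule UnI1, rule insertI2, rule CollectI, rule exI[of _ 1]) (use assms(1) in simp)
  moreover have "(w 1, w g) \<in> parcs (cycle_graph g w)"
    unfolding cycle_graph_arcs by (rule UnI2, rule converseI, rule insertI1)
  ultimately have "{w 2, w g} \<subseteq> ?A" using w(2) by (auto simp: numeral_2_eq_2)
  moreover have "finite ?A"
    by (rule finite_subset[of _ "pverts (cycle_graph g w)"])
      (use cycle_graph_wf(1)[OF assms(1) w(1)] in \<open>auto simp: cycle_graph_arcs(2)\<close>)
  moreover have "w 2 \<noteq> w g" using assms(1) inj_onD[OF w(1), of 2 g] by auto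
  ultimately have "2 \<le> card ?A" using card_mono[of ?A "{w 2, w g}"] by simp
  then show ?thesis unfolding w(3) .
qed

lemma char_entry_image:
  assumes "inj_on u S" "E \<subseteq> S \<times> S" "i \<in> S" "j \<in> S"
  shows "char_entry (map_prod u u ` E) (u i) (u j) = char_entry E i j"
proof -
  have eq: "u i = u j \<longleftrightarrow> i = j" using assms by (meson inj_on_eq_iff)
  have pull: "(a, b) \<in> E" if ab: "(u a, u b) \<in> map_prod u u ` E" "a \<in> S" "b \<in> S" for a b
  proof -
    obtain e where e: "(u a, u b) = map_prod u u e" "e \<in> E" using ab(1) by (rule imageE)
    obtain c d where cd': "e = (c, d)" by (rule prod.exhaust)
    have cd: "(c, d) \<in> E" "u a = u c" "u b = u d" using e unfolding cd' by simp_all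
    then have "c \<in> S" "d \<in> S" using assms(2) by auto
    then have "a = c" "b = d" using cd ab(2,3) inj_onD[OF assms(1)] by metis+
    then show ?thesis using cd by simp
  qed
  have mem: "(u a, u b) \<in> map_prod u u ` E \<longleftrightarrow> (a, b) \<in> E" if ab: "a \<in> S" "b \<in> S" for a b
  proof
    assume "(a, b) \<in> E"
    then have "map_prod u u (a, b) \<in> map_prod u u ` E" by (rule imageI)
    then show "(u a, u b) \<in> map_prod u u ` E" by simp
  qed (rule pull[OF _ ab])
  have "(map_prod u u ` E) `` {u i} = u ` (E `` {i})"
  proof (rule Set.equalityI; rule subsetI)
    fix z assume "z \<in> (map_prod u u ` E) `` {u i}"
    then have z: "(u i, z) \<in> map_prod u u ` E" by simp
    then obtain e where e: "(u i, z) = map_prod u u e" "e \<in> E" by (rule imageE)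
    obtain c d where cd: "e = (c, d)" by (rule prod.exhaust)
    have d: "z = u d" "d \<in> S" using e assms(2) unfolding cd by auto
    then have "(i, d) \<in> E" using z mem[OF assms(3) d(2)] by simp
    then show "z \<in> u ` (E `` {i})" using d(1) by simp
  next
    fix z assume "z \<in> u ` (E `` {i})"
    then obtain d where d: "z = u d" "(i, d) \<in> E" by auto
    then have "d \<in> S" using assms(2) by auto
    then show "z \<in> (map_prod u u ` E) `` {u i}" using mem[OF assms(3)] d by simp
  qed
  moreover have "inj_on u (E `` {i})" using assms(1,2) by (auto simp: inj_on_def)
  ultimately have "card ((map_prod u u ` E) `` {u i}) = card (E `` {i})" by (simp add: card_image)
  then show ?thesis
    unfolding char_entry_def lap_entry_def eq mem[OF assms(3,4)] by (simp only:)
qed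

lemma consecutive_pairs_image:
  "{(u i, u (Suc i)) | i. i \<in> I} = (\<lambda>i. (u i, u (Suc i))) ` I"
  by (rule Setcompr_eq_image)

lemma cycle_graph_image: "parcs (cycle_graph g u) = map_prod u u ` parcs (cycle_graph g id)"
proof -
  have conv: "map_prod u u ` A\<inverse> = (map_prod u u ` A)\<inverse>" for A
    by force
  show ?thesis
    unfolding cycle_graph_arcs consecutive_pairs_image image_Un conv image_insert image_image
    by simp
qed

text \<open>The vertex types of the two graphs differ; the cycle on the numbers 1 to
  \<open>g\<close> provides a common value for both.\<close>

definition cycle_full_poly :: "nat \<Rightarrow> real poly" where
  "cycle_full_poly g = set_det {1..g} (char_entry (parcs (cycle_graph g id)))"

definition cycle_root_poly :: "nat \<Rightarrow> real poly" where
  "cycle_root_poly g = set_det ({1..g} - {1}) (char_entry (parcs (cycle_graph g id)))"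

lemma set_det_cycle_graph:
  assumes "3 \<le> g" "inj_on u {1..g}"
  shows "set_det (pverts (cycle_graph g u)) (char_entry (parcs (cycle_graph g u))) = cycle_full_poly g"
    and "r \<in> pverts (cycle_graph g u) \<Longrightarrow>
      set_det (pverts (cycle_graph g u) - {r}) (char_entry (parcs (cycle_graph g u))) = cycle_root_poly g"
proof -
  have *: "set_det (w ` S) (char_entry (parcs (cycle_graph g w)))
      = set_det S (char_entry (parcs (cycle_graph g id)))"
    if "inj_on w {1..g}" "S \<subseteq> {1..g}" for w :: "nat \<Rightarrow> 'a" and S
  proof -
    have bij: "bij_betw w S (w ` S)" using that inj_on_subset by (auto simp: bij_betw_def)
    have "parcs (cycle_graph g id) \<subseteq> {1..g} \<times> {1..g}"
      using cycle_graph_wf(1)[OF assms(1), of id] by (simp add: cycle_graph_arcs(2))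
    then show ?thesis
      unfolding set_det_reindex[OF bij finite_subset[OF that(2) finite_atLeastAtMost]]
        cycle_graph_image[of g w]
      using that by (intro set_det_cong char_entry_image[where S = "{1..g}"]) auto
  qed
  show "set_det (pverts (cycle_graph g u)) (char_entry (parcs (cycle_graph g u))) = cycle_full_poly g"
    unfolding cycle_full_poly_def cycle_graph_arcs(2) by (rule *[OF assms(2)]) simp
  assume "r \<in> pverts (cycle_graph g u)"
  then obtain j where "j \<in> {1..g}" "r = u j" by (auto simp: cycle_graph_arcs)
  then obtain w where w: "inj_on w {1..g}" "w 1 = r" "cycle_graph g w = cycle_graph g u"
    using cycle_graph_rotate[OF _ assms(2), of j] assms(1) by auto
  have "w ` {1..g} - {r} = w ` ({1..g} - {1})"
    using inj_on_image_set_diff[OF w(1), of "{1..g}" "{1}"] w(2) assms(1) by simp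
  then show "set_det (pverts (cycle_graph g u) - {r}) (char_entry (parcs (cycle_graph g u))) = cycle_root_poly g"
    unfolding w(3)[symmetric] cycle_graph_arcs(2)[of g w] cycle_root_poly_def
    using *[OF w(1), of "{1..g} - {1}"] by simp
qed

section \<open>Balanced starlike trees\<close>

lemma path_graph_realizes:
  assumes "inj_on p {1..Suc k}"
  shows "realizes (pverts (path_graph (Suc k) p)) (parcs (path_graph (Suc k) p)) (p 1) (path_tree k)"
  using assms
proof (induction k arbitrary: p)
  case 0
  then show ?case by (simp add: path_graph_arcs realizes.single)
next
  case (Suc k)
  let ?q = "\<lambda>i. p (Suc i)"
  have "inj_on ?q {1..Suc k}"
  proof (rule inj_onI)
    fix x y assume "x \<in> {1..Suc k}" "y \<in> {1..Suc k}" "?q x = ?q y"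
    then show "x = y" using inj_onD[OF Suc.prems, of "Suc x" "Suc y"] by auto
  qed
  then have "realizes (pverts (path_graph (Suc k) ?q)) (parcs (path_graph (Suc k) ?q)) (?q 1) (path_tree k)"
    by (rule Suc.IH)
  moreover have "pverts (path_graph (Suc k) ?q) \<inter> {p 1} = {}"
  proof -
    have "p 1 \<noteq> p (Suc i)" if "i \<in> {1..Suc k}" for i
      using that inj_onD[OF Suc.prems, of 1 "Suc i"] by auto
    then have "p 1 \<notin> ?q ` {1..Suc k}" by blast
    then show ?thesis by (simp add: path_graph_arcs)
  qed
  ultimately have *: "realizes (pverts (path_graph (Suc k) ?q) \<union> {p 1})
      (parcs (path_graph (Suc k) ?q) \<union> {} \<union> {(p 1, ?q 1), (?q 1, p 1)}) (p 1) (Branch (path_tree k) Root)"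
    by (intro realizes.branch realizes.single)
  have "{1..Suc (Suc k)} = insert 1 (Suc ` {1..Suc k})"
    by (auto simp: image_Suc_atLeastAtMost)
  then have "p ` {1..Suc (Suc k)} = insert (p 1) (?q ` {1..Suc k})"
    by (simp only: image_insert image_image)
  then have V: "pverts (path_graph (Suc (Suc k)) p) = pverts (path_graph (Suc k) ?q) \<union> {p 1}"
    unfolding path_graph_arcs(2) by simp
  have "{1..<Suc (Suc k)} = insert 1 (Suc ` {1..<Suc k})"
    by (auto simp: image_Suc_atLeastLessThan)
  then have E: "{(p i, p (Suc i)) | i. i \<in> {1..<Suc (Suc k)}}
      = insert (p 1, ?q 1) {(?q i, ?q (Suc i)) | i. i \<in> {1..<Suc k}}"
    unfolding consecutive_pairs_image[of p] consecutive_pairs_image[of ?q]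
    by (simp only: image_insert image_image One_nat_def)
  have "parcs (path_graph (Suc (Suc k)) p)
      = parcs (path_graph (Suc k) ?q) \<union> {} \<union> {(p 1, ?q 1), (?q 1, p 1)}"
    unfolding path_graph_arcs(1) E by auto
  with * V show ?case by simp
qed

lemma num_edges_star_tree: "num_edges (star_tree ks) = sum_list ks"
proof -
  have "num_edges (path_tree k) = k" for k by (induction k) auto
  then show ?thesis by (induction ks) auto
qed

text \<open>For \<open>m = 0\<close> the union is empty; \<open>insert c\<close> supplies the
  center.\<close>

lemma star_of_paths_realizes:
  assumes "\<And>j. j \<in> {1..m} \<Longrightarrow> realizes (V j) (E j) c (path_tree (k j))"
    and "\<And>i j. i \<in> {1..m} \<Longrightarrow> j \<in> {1..m} \<Longrightarrow> i \<noteq> j \<Longrightarrow> V i \<inter> V j = {c}"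
  shows "realizes (insert c (\<Union>j\<in>{1..m}. V j)) (\<Union>j\<in>{1..m}. E j) c (star_tree (map k [1..<Suc m]))"
  using assms
proof (induction m)
  case 0
  then show ?case by (simp add: realizes.single)
next
  case (Suc m)
  have IH: "realizes (insert c (\<Union>j\<in>{1..m}. V j)) (\<Union>j\<in>{1..m}. E j) c (star_tree (map k [1..<Suc m]))"
    using Suc.prems by (intro Suc.IH) auto
  have new: "realizes (V (Suc m)) (E (Suc m)) c (path_tree (k (Suc m)))"
    using Suc.prems(1) by simp
  have c: "c \<in> V (Suc m)" using realizes_basic[OF new] by simp
  have int: "insert c (\<Union>j\<in>{1..m}. V j) \<inter> V (Suc m) = {c}"
  proof -
    have "V j \<inter> V (Suc m) = {c}" if "j \<in> {1..m}" for j
      using that by (intro Suc.prems(2)) auto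
    then show ?thesis using c by blast
  qed
  have un: "(\<Union>j\<in>{1..Suc m}. F j) = (\<Union>j\<in>{1..m}. F j) \<union> F (Suc m)" for F :: "nat \<Rightarrow> 'c set"
    by (auto simp: atLeastAtMostSuc_conv)
  have "realizes (insert c (\<Union>j\<in>{1..m}. V j) \<union> V (Suc m)) ((\<Union>j\<in>{1..m}. E j) \<union> E (Suc m)) c
      (glue (star_tree (map k [1..<Suc m])) (path_tree (k (Suc m))))"
    by (rule realizes_glue[OF IH new int])
  moreover have "star_tree (map k [1..<Suc (Suc m)]) = glue (star_tree (map k [1..<Suc m])) (path_tree (k (Suc m)))"
    by (simp add: star_tree_append)
  ultimately show ?case unfolding un by (simp add: Un_insert_left)
qed

lemma is_BST_realizes:
  assumes B: "is_BST (Suc m) l c B" and l: "1 \<le> l"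
  shows "\<exists>ks. realizes (pverts B) (parcs B) c (star_tree ks) \<and> balanced ks \<and> length ks = l \<and> sum_list ks = m"
proof -
  have rm: "real (Suc m) - 1 = real m" by simp
  have order: "graph_order B = Suc m"
    using B unfolding is_BST_def by (rule conjunct1)
  obtain k p where
    "(\<forall>j\<in>{1..l}. k j = nat \<lfloor>real m / real l\<rfloor> + 1 \<or> k j = nat \<lceil>real m / real l\<rceil> + 1)
      \<and> (\<forall>j\<in>{1..l}. inj_on (p j) {1..k j} \<and> p j 1 = c)
      \<and> (\<forall>i\<in>{1..l}. \<forall>j\<in>{1..l}. i \<noteq> j \<longrightarrow>
           pverts (path_graph (k i) (p i)) \<inter> pverts (path_graph (k j) (p j)) = {c})
      \<and> pverts B = (\<Union>j\<in>{1..l}. pverts (path_graph (k j) (p j)))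
      \<and> parcs B = (\<Union>j\<in>{1..l}. parcs (path_graph (k j) (p j)))"
    using conjunct2[OF B[unfolded is_BST_def rm]] by (elim exE)
  then have k: "\<And>j. j \<in> {1..l} \<Longrightarrow> k j = nat \<lfloor>real m / real l\<rfloor> + 1 \<or> k j = nat \<lceil>real m / real l\<rceil> + 1"
    and p: "\<And>j. j \<in> {1..l} \<Longrightarrow> inj_on (p j) {1..k j} \<and> p j 1 = c"
    and disj: "\<And>i j. i \<in> {1..l} \<Longrightarrow> j \<in> {1..l} \<Longrightarrow> i \<noteq> j \<Longrightarrow>
       pverts (path_graph (k i) (p i)) \<inter> pverts (path_graph (k j) (p j)) = {c}"
    and V: "pverts B = (\<Union>j\<in>{1..l}. pverts (path_graph (k j) (p j)))"
    and E: "parcs B = (\<Union>j\<in>{1..l}. parcs (path_graph (k j) (p j)))"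
    by simp_all
  let ?ks = "map (\<lambda>j. k j - 1) [1..<Suc l]"
  have path: "realizes (pverts (path_graph (k j) (p j))) (parcs (path_graph (k j) (p j))) c (path_tree (k j - 1))"
    if "j \<in> {1..l}" for j
  proof -
    have "k j = Suc (k j - 1)" using k[OF that] by auto
    then show ?thesis using path_graph_realizes[of "p j" "k j - 1"] p[OF that] by metis
  qed
  have "c \<in> pverts B" using realizes_basic[OF path[of 1]] l unfolding V by auto
  then have c: "insert c (pverts B) = pverts B" by auto
  have real: "realizes (pverts B) (parcs B) c (star_tree ?ks)"
    using star_of_paths_realizes[where V = "\<lambda>j. pverts (path_graph (k j) (p j))"
        and E = "\<lambda>j. parcs (path_graph (k j) (p j))" and k = "\<lambda>j. k j - 1" and m = l, OF path disj]
    unfolding V[symmetric] E[symmetric] c .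
  \<comment> \<open>Each \<open>k j\<close> counts vertices including the center, so
    \<open>k j - 1\<close> counts edges, and their total follows from the order
    \<open>Suc m\<close>.\<close>
  have "sum_list ?ks = m"
    using realizes_basic[OF real] order by (simp add: graph_order_def num_edges_star_tree)
  moreover have "balanced ?ks"
  proof -
    let ?a = "real m / real l"
    have fc: "\<lfloor>?a\<rfloor> \<le> \<lceil>?a\<rceil>" "\<lceil>?a\<rceil> \<le> \<lfloor>?a\<rfloor> + 1" "0 \<le> \<lfloor>?a\<rfloor>"
      using ceiling_diff_floor_le_1[of ?a] floor_le_ceiling[of ?a] by simp_all
    have "nat \<lfloor>?a\<rfloor> \<le> nat \<lceil>?a\<rceil>" "nat \<lceil>?a\<rceil> \<le> Suc (nat \<lfloor>?a\<rfloor>)"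
      using fc by linarith+
    then have "k i - 1 \<le> Suc (k j - 1)" if "i \<in> {1..l}" "j \<in> {1..l}" for i j
      using k[OF that(1)] k[OF that(2)] by linarith
    then show ?thesis by (auto simp: balanced_def)
  qed
  moreover have "length ?ks = l" by simp
  ultimately show ?thesis using real by blast
qed

section \<open>Comparison of the two graphs\<close>

lemma laplacian_coeff_eq:
  assumes "finite (pverts G)" "k \<le> graph_order G"
  shows "laplacian_coeff G k = coeff (set_det (pverts G) (char_entry (parcs G))) (graph_order G - k)"
proof -
  have "even (graph_order G + (graph_order G - k)) \<longleftrightarrow> even k" using assms(2) by presburger
  then have "(-1 :: real) ^ (graph_order G + (graph_order G - k)) = (-1) ^ k"
    by (simp add: uminus_power_if)
  then show ?thesis
    unfolding laplacian_coeff_def coeff_set_det_char_entry[OF assms(1)] by simp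
qed

lemma coeff_set_det_eq_0:
  assumes "finite (pverts G)" "graph_order G < i"
  shows "coeff (set_det (pverts G) (char_entry (parcs G))) i = 0"
proof -
  obtain vs where vs: "distinct vs" "set vs = pverts G" using finite_distinct_list assms(1) by blast
  have "laplacian_mat G vs \<in> carrier_mat (length vs) (length vs)"
    unfolding laplacian_mat_def adjacency_mat_def by (rule minus_carrier_mat, rule mat_carrier)
  then have "degree (laplacian_poly G) = length vs"
    unfolding laplacian_poly_eq[OF vs] by (simp add: degree_monic_char_poly)
  also have "length vs = graph_order G"
    using vs distinct_card by (fastforce simp: graph_order_def)
  finally show ?thesis
    using assms(2) by (simp add: coeff_set_det_char_entry[OF assms(1)] coeff_eq_0)
qed

text \<open>Different values at 1 force some coefficients to differ, and the order decides the
  direction. Its index is at most the order, as higher coefficients vanish in both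
  polynomials.\<close>

lemma lap_lessI:
  assumes fin: "finite (pverts G)" "finite (pverts H)" and order: "graph_order H = graph_order G"
    and le: "set_det (pverts H) (char_entry (parcs H)) \<le>\<^sub>p set_det (pverts G) (char_entry (parcs G))"
    and less: "poly (set_det (pverts H) (char_entry (parcs H))) 1 < poly (set_det (pverts G) (char_entry (parcs G))) 1"
  shows "H \<prec>\<^sub>L G"
proof -
  let ?G = "set_det (pverts G) (char_entry (parcs G))" and ?H = "set_det (pverts H) (char_entry (parcs H))"
  have coeff_le: "coeff ?H i \<le> coeff ?G i" for i
    using le by (simp add: nonneg_poly_def)
  have "?H \<noteq> ?G" using less by auto
  then obtain i where "coeff ?H i \<noteq> coeff ?G i" by (auto simp: poly_eq_iff)
  then have i: "coeff ?H i < coeff ?G i" using coeff_le[of i] by simp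
  have "i \<le> graph_order G"
  proof (rule ccontr)
    assume "\<not> i \<le> graph_order G"
    then show False
      using i coeff_set_det_eq_0[OF fin(1), of i] coeff_set_det_eq_0[OF fin(2), of i] order by simp
  qed
  then have "laplacian_coeff H (graph_order G - i) < laplacian_coeff G (graph_order G - i)"
    using i order by (simp add: laplacian_coeff_eq fin)
  moreover have "H \<preceq>\<^sub>L G"
    unfolding lap_le_def using order coeff_le by (simp add: laplacian_coeff_eq fin)
  ultimately show ?thesis
    unfolding lap_less_def using order by (intro conjI exI[of _ "graph_order G - i"]) auto
qed

lemma unicyclic_graphs2E:
  assumes "3 \<le> g" "G \<in> unicyclic_graphs2 n l g"
  obtains u r r' V E t V' E' t' where
    "inj_on u {1..g}" "realizes V E r t" "realizes V' E' r' t'"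
    "pverts (cycle_graph g u) \<inter> V = {r}" "pverts (cycle_graph g u) \<inter> V' = {r'}" "V \<inter> V' = {}"
    "t \<noteq> Root" "t' \<noteq> Root"
    "pverts G = pverts (cycle_graph g u) \<union> V \<union> V'" "parcs G = parcs (cycle_graph g u) \<union> E \<union> E'"
    "graph_order G = n" "card (leaves G) = l"
proof -
  obtain u T i where order: "graph_order G = n" and leaves: "card (leaves G) = l"
    and cwt: "cycle_with_trees g u T G" and T1: "graph_order (T 1) > 1"
    and i: "i \<in> {1..g}" "i \<noteq> 1" "graph_order (T i) > 1"
    and triv: "\<And>j. j \<in> {1..g} \<Longrightarrow> j \<noteq> 1 \<Longrightarrow> j \<noteq> i \<Longrightarrow> graph_order (T j) = 1"
    using assms(2) unfolding unicyclic_graphs2_def unicyclic_graphs_def by blast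
  have inj: "inj_on u {1..g}"
    and tree: "\<And>j. j \<in> {1..g} \<Longrightarrow> is_tree (T j)" and root: "\<And>j. j \<in> {1..g} \<Longrightarrow> u j \<in> pverts (T j)"
    and disj: "\<And>j k. j \<in> {1..g} \<Longrightarrow> k \<in> {1..g} \<Longrightarrow> j \<noteq> k \<Longrightarrow> pverts (T j) \<inter> pverts (T k) = {}"
    and V: "pverts G = pverts (cycle_graph g u) \<union> (\<Union>j\<in>{1..g}. pverts (T j))"
    and E: "parcs G = parcs (cycle_graph g u) \<union> (\<Union>j\<in>{1..g}. parcs (T j))"
    using cwt unfolding cycle_with_trees_def by simp_all
  have one: "1 \<in> {1..g}" using assms(1) by simp
  obtain t where t: "realizes (pverts (T 1)) (parcs (T 1)) (u 1) t"
    using is_tree_realizes[OF tree root] one by blast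
  obtain t' where t': "realizes (pverts (T i)) (parcs (T i)) (u i) t'"
    using is_tree_realizes[OF tree root] i by blast
  have trivial: "pverts (T j) = {u j} \<and> parcs (T j) = {}" if j: "j \<in> {1..g}" "j \<noteq> 1" "j \<noteq> i" for j
  proof -
    obtain s where s: "realizes (pverts (T j)) (parcs (T j)) (u j) s"
      using is_tree_realizes[OF tree root] j by blast
    have "card (pverts (T j)) = 1" using triv[OF j] by (simp add: graph_order_def)
    then have "pverts (T j) = {u j}" using root[OF j(1)] by (auto simp: card_1_singleton_iff)
    then show ?thesis using realizes_basic[OF s] by auto
  qed
  have meet: "pverts (cycle_graph g u) \<inter> pverts (T j) = {u j}" if j: "j \<in> {1..g}" for j
    using root disj j by (fastforce simp: cycle_graph_arcs(2))
  have "(\<Union>j\<in>{1..g}. pverts (T j)) \<union> pverts (cycle_graph g u)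
      = pverts (T 1) \<union> pverts (T i) \<union> pverts (cycle_graph g u)"
  proof -
    have "pverts (T j) \<subseteq> pverts (T 1) \<union> pverts (T i) \<union> pverts (cycle_graph g u)" if "j \<in> {1..g}" for j
      using trivial[OF that] that by (cases "j = 1 \<or> j = i") (auto simp: cycle_graph_arcs(2))
    then show ?thesis using one i(1) by blast
  qed
  then have VG: "pverts G = pverts (cycle_graph g u) \<union> pverts (T 1) \<union> pverts (T i)"
    unfolding V by blast
  have "(\<Union>j\<in>{1..g}. parcs (T j)) = parcs (T 1) \<union> parcs (T i)"
  proof -
    have "parcs (T j) \<subseteq> parcs (T 1) \<union> parcs (T i)" if "j \<in> {1..g}" for j
      using trivial[OF that] by (cases "j = 1 \<or> j = i") auto
    then show ?thesis using one i(1) by blast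
  qed
  then have EG: "parcs G = parcs (cycle_graph g u) \<union> parcs (T 1) \<union> parcs (T i)"
    unfolding E by blast
  have "t \<noteq> Root" "t' \<noteq> Root"
    using T1 i(3) realizes_basic[OF t] realizes_basic[OF t'] by (auto simp: graph_order_def)
  then show ?thesis
    using that[OF inj t t' meet[OF one] meet[OF i(1)] disj[OF one i(1)] _ _ VG EG order leaves] i(2) by blast
qed

text \<open>Cycle vertices have degree at least 2, so leaves are exactly the non-root leaves of the
  two trees; this matches the convention of \<open>num_leaves\<close>.\<close>

lemma card_leaves_two_trees:
  assumes g: "3 \<le> g" and u: "inj_on u {1..g}"
    and t: "realizes V E r t" and t': "realizes V' E' r' t'"
    and U: "pverts (cycle_graph g u) \<inter> V = {r}" "pverts (cycle_graph g u) \<inter> V' = {r'}" and disj: "V \<inter> V' = {}"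
    and G: "pverts G = pverts (cycle_graph g u) \<union> V \<union> V'" "parcs G = parcs (cycle_graph g u) \<union> E \<union> E'"
  shows "card (leaves G) = num_leaves t + num_leaves t'"
proof -
  let ?U = "pverts (cycle_graph g u)" and ?C = "parcs (cycle_graph g u)"
  let ?L = "{v \<in> V - {r}. card (E `` {v}) = 1}" and ?L' = "{v \<in> V' - {r'}. card (E' `` {v}) = 1}"
  note V = realizes_basic[OF t] and V' = realizes_basic[OF t']
  note C = cycle_graph_wf(1)[OF g u]
  have finU: "finite ?U" by (simp add: cycle_graph_arcs(2))
  have finV: "finite (pverts G)" using finU V V' G by simp
  have wf: "parcs G \<subseteq> pverts G \<times> pverts G" using C V V' unfolding G by blast
  have a: "parcs G `` {v} = E `` {v}" if "v \<in> V - {r}" for v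
  proof -
    have "v \<notin> ?U" "v \<notin> V'" using that U(1) disj by blast+
    then have "?C `` {v} = {}" "E' `` {v} = {}" using C V' by blast+
    then show ?thesis unfolding G by (simp add: Un_Image)
  qed
  have b: "parcs G `` {v} = E' `` {v}" if "v \<in> V' - {r'}" for v
  proof -
    have "v \<notin> ?U" "v \<notin> V" using that U(2) disj by blast+
    then have "?C `` {v} = {}" "E `` {v} = {}" using C V by blast+
    then show ?thesis unfolding G by (simp add: Un_Image)
  qed
  have c: "card (parcs G `` {v}) \<noteq> 1" if v: "v \<in> ?U" for v
  proof -
    have "finite (parcs G `` {v})" using wf finV by (auto intro: finite_subset[of _ "pverts G"])
    moreover have "?C `` {v} \<subseteq> parcs G `` {v}" unfolding G by blast
    ultimately have "card (?C `` {v}) \<le> card (parcs G `` {v})" by (rule card_mono)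
    then show ?thesis using cycle_graph_degree[OF g u v] by linarith
  qed
  have "leaves G = ?L \<union> ?L'"
  proof (rule Set.set_eqI)
    fix v
    have cover: "v \<in> pverts G \<longleftrightarrow> v \<in> ?U \<or> v \<in> V - {r} \<or> v \<in> V' - {r'}"
      using U V V' unfolding G by blast
    consider "v \<in> ?U" | "v \<in> V - {r}" "v \<notin> ?U" "v \<notin> V'" | "v \<in> V' - {r'}" "v \<notin> ?U" "v \<notin> V"
      | "v \<notin> pverts G"
      using cover U disj by blast
    then show "v \<in> leaves G \<longleftrightarrow> v \<in> ?L \<union> ?L'"
    proof cases
      case 1
      then have "v \<notin> ?L" "v \<notin> ?L'" using U by blast+
      then show ?thesis using c[OF 1] by (simp add: leaves_def out_degree_eq)
    next
      case 2
      then show ?thesis using a[OF 2(1)] cover by (simp add: leaves_def out_degree_eq)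
    next
      case 3
      then show ?thesis using b[OF 3(1)] cover by (simp add: leaves_def out_degree_eq)
    next
      case 4
      then have "v \<notin> V - {r}" "v \<notin> V' - {r'}" using cover by blast+
      then show ?thesis using 4 by (auto simp: leaves_def)
    qed
  qed
  moreover have "finite ?L" "finite ?L'" using V V' by auto
  moreover have "?L \<inter> ?L' = {}" using disj by blast
  ultimately have "card (leaves G) = card ?L + card ?L'" by (simp add: card_Un_disjoint)
  then show ?thesis unfolding realizes_leaves[OF t] realizes_leaves[OF t'] .
qed

theorem theorem3p4:
  fixes G :: "'a pair_pre_digraph" and H :: "'b pair_pre_digraph" and n l g :: nat
  assumes "g \<ge> 3"
    and "G \<in> unicyclic_graphs2 n l g"
    and "is_U0 n l g H"
  shows "H \<prec>\<^sub>L G"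
proof -
  obtain u r r' V E t V' E' t' where
    u: "inj_on u {1..g}" and t: "realizes V E r t" and t': "realizes V' E' r' t'"
    and U: "pverts (cycle_graph g u) \<inter> V = {r}" "pverts (cycle_graph g u) \<inter> V' = {r'}" and disj: "V \<inter> V' = {}"
    and nt: "t \<noteq> Root" "t' \<noteq> Root"
    and G: "pverts G = pverts (cycle_graph g u) \<union> V \<union> V'" "parcs G = parcs (cycle_graph g u) \<union> E \<union> E'"
    and n: "graph_order G = n" and l: "card (leaves G) = l"
    using unicyclic_graphs2E[OF assms(1,2)] by metis
  let ?U = "pverts (cycle_graph g u)" and ?C = "parcs (cycle_graph g u)"
  note V = realizes_basic[OF t] and V' = realizes_basic[OF t']
  note C = cycle_graph_wf[OF assms(1) u]
  have finU: "finite ?U" and cardU: "card ?U = g"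
    using u by (simp_all add: cycle_graph_arcs(2) card_image)
  have rU: "r \<in> ?U" "r' \<in> ?U" using U by auto
  let ?m = "num_edges t + num_edges t'"
  have "card (?U \<union> V) = g + num_edges t"
    using card_Un_Int[OF finU, of V] V U(1) cardU by simp
  moreover have "(?U \<union> V) \<inter> V' = {r'}" using U(2) disj by blast
  ultimately have order: "n = g + ?m"
    using card_Un_Int[of "?U \<union> V" V'] finU V V' n G(1) by (simp add: graph_order_def)
  have leaves: "l = num_leaves t + num_leaves t'"
    using card_leaves_two_trees[OF assms(1) u t t' U disj G] l by simp
  have l1: "1 \<le> l" using leaves nt num_leaves_eq_0[of t] by simp

  obtain w c B where w: "inj_on w {1..g}" and B: "is_BST (Suc ?m) l c B"
    and W: "pverts (cycle_graph g w) \<inter> pverts B = {c}"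
    and H: "pverts H = pverts (cycle_graph g w) \<union> pverts B" "parcs H = parcs (cycle_graph g w) \<union> parcs B"
    using assms(3) order unfolding is_U0_def by auto
  obtain ks where ks: "realizes (pverts B) (parcs B) c (star_tree ks)" "balanced ks" "length ks = l" "sum_list ks = ?m"
    using is_BST_realizes[OF B l1] by blast
  let ?W = "pverts (cycle_graph g w)"
  note VB = realizes_basic[OF ks(1)] and D = cycle_graph_wf[OF assms(1) w]
  have finW: "finite ?W" and cardW: "card ?W = g"
    using w by (simp_all add: cycle_graph_arcs(2) card_image)
  have finH: "finite (pverts H)" using finW VB H by simp
  have orderH: "graph_order H = n"
    using card_Un_Int[OF finW, of "pverts B"] VB W cardW H(1) order ks(4)
    by (simp add: graph_order_def num_edges_star_tree)

  define q where "q = cycle_full_poly g"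
  define p where "p = cycle_root_poly g"
  define p' where "p' = set_det (?U - {r'} - {r}) (char_entry ?C)"
  note cyc = set_det_cycle_graph[OF assms(1) u]
  have p: "nonneg_poly p"
    using set_det_char_entry_nonneg[OF finU C(1), of "?U - {r}"] cyc(2)[OF rU(1)] by (auto simp: p_def)
  have qp: "X * p \<le>\<^sub>p q"
    using set_det_char_entry_root[OF finU C(1) rU(1)] unfolding cyc(1) cyc(2)[OF rU(1)] p_def q_def .
  have p': "nonneg_poly p'" "0 < poly p' 1"
    using set_det_char_entry_nonneg[OF finU C(1), of "?U - {r'} - {r}"] by (auto simp: p'_def)

  let ?T = "glue t t'" and ?S = "star_tree ks"
  have PG: "set_det (pverts G) (char_entry (parcs G))
      = q * root_poly ?T + p * nonroot_poly ?T + p' * (nonroot_poly t * nonroot_poly t')"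
    unfolding G set_det_attach_two[OF t t' finU C(1) C(2) U disj] cyc(1) cyc(2)[OF rU(1)] cyc(2)[OF rU(2)]
    by (simp add: q_def p_def p'_def algebra_simps)
  have PH: "set_det (pverts H) (char_entry (parcs H)) = q * root_poly ?S + p * nonroot_poly ?S"
  proof -
    have c: "c \<in> ?W" using W by auto
    show ?thesis
      unfolding H set_det_attach_graph[OF ks(1) finW D(1) D(2) W subset_refl c]
        set_det_cycle_graph(1)[OF assms(1) w] set_det_cycle_graph(2)[OF assms(1) w c]
      by (simp add: q_def p_def)
  qed
  have split: "q * root_poly s + p * nonroot_poly s = (q - X * p) * root_poly s + p * full_poly s" for s
    by (simp add: full_poly_def algebra_simps)
  obtain a b where ab: "t = Branch a b" using nt(1) by (cases t) auto
  \<comment> \<open>Nontriviality of both trees gives the glued tree a second child at its root, as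
    the comparison of \<open>A\<close> requires.\<close>
  have "glue b t' \<noteq> Root" using nt(2) by (cases b) auto
  then have "root_poly ?S \<le>\<^sub>p root_poly ?T" "full_poly ?S \<le>\<^sub>p full_poly ?T"
    using balanced_star_minimal[of "glue b t'" ks a] ks leaves unfolding ab by simp_all
  then have "q * root_poly ?S + p * nonroot_poly ?S \<le>\<^sub>p q * root_poly ?T + p * nonroot_poly ?T"
    unfolding split using p qp by (intro coeff_le_add coeff_le_mult)
  then have star: "nonneg_poly (q * root_poly ?T + p * nonroot_poly ?T - (q * root_poly ?S + p * nonroot_poly ?S))" .
  let ?R = "p' * (nonroot_poly t * nonroot_poly t')"
  have R: "nonneg_poly ?R" "0 < poly ?R 1"
    using p' nt nonroot_poly_at_1[of t] nonroot_poly_at_1[of t'] by (auto intro!: nonneg_poly_mult)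
  have diff: "set_det (pverts G) (char_entry (parcs G)) - set_det (pverts H) (char_entry (parcs H))
    = (q * root_poly ?T + p * nonroot_poly ?T - (q * root_poly ?S + p * nonroot_poly ?S)) + ?R"
    unfolding PG PH by simp
  show ?thesis
  proof (rule lap_lessI)
    show "finite (pverts G)" using finU V V' G by simp
    show "set_det (pverts H) (char_entry (parcs H)) \<le>\<^sub>p set_det (pverts G) (char_entry (parcs G))"
      unfolding diff using star R(1) by (rule nonneg_poly_add)
    have "0 < poly (set_det (pverts G) (char_entry (parcs G)) - set_det (pverts H) (char_entry (parcs H))) 1"
      unfolding diff poly_add using nonneg_poly_poly[OF star, of 1] R(2) by simp
    then show "poly (set_det (pverts H) (char_entry (parcs H))) 1 < poly (set_det (pverts G) (char_entry (parcs G))) 1"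
      by simp
  qed (use finH orderH n in auto)
qed

end
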